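(* Let $\dot{\mathbb{R}}$ be the one-point compactification of $\mathbb{R}$, let $\Omega=\dot{\mathbb{R}}^{\mathbb{N}}$ be the infinite product, let $\mathscr{F}$ be the $\sigma$-algebra generated by the cylinder sets, and let $(\Omega,\mathscr{F},\mathbb{P})$ be a probability space. Let $\mathscr{W}$ be a separating system of continuous random variables $X:\Omega\to\mathbb{R}$, and let $\varphi:\mathbb{R}\to\mathbb{R}$ be a fixed continuous function such that $\lim_{t\to-\infty}\varphi(t)=0$ and $\lim_{t\to+\infty}\varphi(t)=1$. Then the linear span of the system of functions on $\Omega$ $$\{\varphi(X(\cdot)+\lambda)\}_{X\in\mathscr{W},\ \lambda\in\mathbb{R}}$$ is uniformly dense in $C(\Omega)$, i.e., dense with respect to the norm $\|\cdot\|_\infty$ on $C(\Omega)$.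
   Context: $\Omega$ carries the topology generated by the cylinder sets (the product topology), in which it is compact. $C(\Omega)$ denotes the continuous functions on $\Omega$. A system $\mathscr{W}$ of random variables $X:\Omega\to\mathbb{R}$ is called separating if the sets $\{X(\cdot)>s\}=X^{-1}((s,\infty])$ and $\{X(\cdot)=s\}=X^{-1}(\{s\})$, with $s\in\mathbb{R}$ and $X\in\mathscr{W}$ arbitrary, generate $\mathscr{F}$ in the following precise sense: if a signed measure $\mu$ on $(\Omega,\mathscr{F})$ of finite total variation vanishes on all of these sets, then $\mu=0$. *)

theory Defs
  imports "HOL-Probability.Probability"
begin

(* 'a option is topologised as the one-point compactification of 'a, with None as the point at
   infinity.  Since nat \<Rightarrow> 'b carries the product topology (Function_Topology), the type
   nat \<Rightarrow> real option is the compact space \<Omega>. *)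
instantiation option :: (topological_space) topological_space
begin

definition open_option :: "'a option set \<Rightarrow> bool"
  where "open_option U \<longleftrightarrow> openin (Alexandroff_compactification euclidean) U"

instance
proof
  have "topspace (Alexandroff_compactification (euclidean :: 'a topology)) = UNIV"
    by (auto simp: UNIV_option_conv)
  then show "open (UNIV :: 'a option set)"
    unfolding open_option_def using openin_topspace by metis
qed (auto simp: open_option_def)

end

lemma euclidean_option:
  "(euclidean :: 'a::topological_space option topology) = Alexandroff_compactification euclidean"
  by (simp add: topology_eq open_openin [symmetric] open_option_def)

lemma compact_UNIV_Omega: "compact (UNIV :: (nat \<Rightarrow> real option) set)"
proof -
  have "compact_space (euclidean :: real option topology)"
    unfolding euclidean_option by (rule compact_space_Alexandroff_compactification)
  then have "compact_space (product_topology (\<lambda>_::nat. (euclidean :: real option topology)) UNIV)"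
    by (simp add: compact_space_product_topology)
  then show ?thesis
    by (simp add: euclidean_product_topology compact_space_def)
qed

(* By compactness the library's space of bounded continuous functions with the sup norm,
   (nat \<Rightarrow> real option) \<Rightarrow>\<^sub>C real, consists of all continuous functions, so it is C(\<Omega>). *)
lemma bcontfun_Omega:
  "(bcontfun :: ((nat \<Rightarrow> real option) \<Rightarrow> real) set) = {f. continuous_on UNIV f}"
  using compact_continuous_image [OF _ compact_UNIV_Omega] compact_imp_bounded
  by (auto simp: bcontfun_def)

definition cylinder_sets :: "(nat \<Rightarrow> 'a::topological_space) set set"
  where "cylinder_sets =
    {{\<omega>. \<forall>i\<in>I. \<omega> i \<in> U i} | I U. finite I \<and> (\<forall>i\<in>I. open (U i))}"

(* Real-valued set functions suffice: only signed measures of finite total variation are needed.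
   The values of \<mu> outside sets M are irrelevant. *)
definition signed_measure :: "'a measure \<Rightarrow> ('a set \<Rightarrow> real) \<Rightarrow> bool"
  where "signed_measure M \<mu> \<longleftrightarrow> \<mu> {} = 0 \<and>
    (\<forall>A :: nat \<Rightarrow> 'a set. range A \<subseteq> sets M \<longrightarrow> disjoint_family A \<longrightarrow>
      (\<lambda>n. \<mu> (A n)) sums \<mu> (\<Union>n. A n))"

definition total_variation :: "'a measure \<Rightarrow> ('a set \<Rightarrow> real) \<Rightarrow> ennreal"
  where "total_variation M \<mu> =
    (SUP A \<in> {A :: nat \<Rightarrow> 'a set. range A \<subseteq> sets M \<and> disjoint_family A \<and> (\<Union>n. A n) = space M}.
      \<Sum>n. ennreal \<bar>\<mu> (A n)\<bar>)"

(* Depends on M only through space M and sets M. *)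
definition separating :: "'a measure \<Rightarrow> ('a \<Rightarrow> real) set \<Rightarrow> bool"
  where "separating M W \<longleftrightarrow>
    (\<forall>\<mu>. signed_measure M \<mu> \<longrightarrow> total_variation M \<mu> < \<infinity> \<longrightarrow>
      (\<forall>X\<in>W. \<forall>s. \<mu> {\<omega> \<in> space M. X \<omega> > s} = 0 \<and> \<mu> {\<omega> \<in> space M. X \<omega> = s} = 0) \<longrightarrow>
      (\<forall>A\<in>sets M. \<mu> A = 0))"

end

theory Submission
  imports Defs
begin

text \<open>
  If the span were not dense, the Hahn--Banach and Riesz theorems would give two distinct finite
  Borel measures \<open>M\<close>, \<open>N\<close> on \<open>\<Omega>\<close> with equal integrals over the span. The Riesz theorem is only needed on
  the Cantor space, where clopen sets have continuous indicators and a finitely additive content on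
  them is automatically countably additive; \<open>\<Omega>\<close> is a continuous image of the Cantor space.

  For \<open>X \<in> W\<close> let \<open>\<nu>\<close> be the difference of the images of \<open>M\<close> and \<open>N\<close> under \<open>X\<close>, a compactly supported signed
  measure on the line with \<open>\<integral> \<phi>(x + c) d\<nu>(x) = 0\<close> for all \<open>c\<close>. Then \<open>\<nu> = 0\<close>: suppose that its moments
  of order less than \<open>m\<close> vanish and let \<open>\<Phi>\<close> be an \<open>m\<close>-fold antiderivative of \<open>\<phi>\<close>. The function
  \<open>h(c) = \<integral> \<Phi>(c + x) d\<nu>(x)\<close> has vanishing \<open>m\<close>-th derivative, so it is a polynomial. By Taylor expansion
  of \<open>\<Phi>\<close> at \<open>c\<close> it tends to \<open>0\<close> at \<open>-\<infinity>\<close> and to the \<open>m\<close>-th moment of \<open>\<nu>\<close> divided by \<open>m!\<close> at \<open>+\<infinity>\<close>.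
  A polynomial with finite limits is constant, so the \<open>m\<close>-th moment vanishes as well. Hence \<open>M - N\<close>
  vanishes on all sets \<open>{X > s}\<close> and \<open>{X = s}\<close>, and the separation property yields \<open>M = N\<close>.
\<close>

section \<open>The Hahn--Banach theorem\<close>

definition sublinear :: "('v::real_vector \<Rightarrow> real) \<Rightarrow> bool"
  where "sublinear p \<longleftrightarrow> (\<forall>x y. p (x + y) \<le> p x + p y) \<and> (\<forall>c x. 0 \<le> c \<longrightarrow> p (c *\<^sub>R x) = c * p x)"

text \<open>Homogeneity may be checked as an inequality for positive factors, since the inequality
  for the inverse factor is the reverse one.\<close>

lemma sublinearI:
  assumes "\<And>x y. p (x + y) \<le> p x + p y"
    and "\<And>c x. 0 < c \<Longrightarrow> p (c *\<^sub>R x) \<le> c * p x"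
    and "p 0 = 0"
  shows "sublinear p"
  unfolding sublinear_def
proof (intro conjI allI impI)
  fix c :: real and x
  assume "0 \<le> c"
  show "p (c *\<^sub>R x) = c * p x"
  proof (cases "c = 0")
    case False
    with \<open>0 \<le> c\<close> have c: "0 < c" by simp
    have "p x = p (inverse c *\<^sub>R c *\<^sub>R x)" using c by simp
    also have "\<dots> \<le> inverse c * p (c *\<^sub>R x)" by (rule assms(2)) (use c in simp)
    finally have "c * p x \<le> p (c *\<^sub>R x)" using c by (simp add: field_simps)
    with assms(2)[OF c, of x] show ?thesis by simp
  qed (simp add: assms(3))
qed (rule assms(1))

lemma sublinear_add: "sublinear p \<Longrightarrow> p (x + y) \<le> p x + p y"
  by (simp add: sublinear_def)

lemma sublinear_scale: "sublinear p \<Longrightarrow> 0 \<le> c \<Longrightarrow> p (c *\<^sub>R x) = c * p x"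
  by (simp add: sublinear_def)

lemma sublinear_zero: "sublinear p \<Longrightarrow> p 0 = 0"
  using sublinear_scale[of p 0 0] by simp

lemma sublinear_neg: "sublinear p \<Longrightarrow> - p (- x) \<le> p x"
  using sublinear_add[of p x "- x"] sublinear_zero[of p] by simp

text \<open>Tilting lowers \<open>p\<close> along the ray spanned by \<open>y\<close>. Parameter 0
  in the infimum gives the first bound and parameter 1 the second. In particular
  \<open>q (- y) \<le> - p y\<close>, so every linear functional below \<open>q\<close> takes the
  value \<open>p y\<close> at \<open>y\<close>.\<close>

lemma sublinear_tilt:
  fixes p :: "'v::real_vector \<Rightarrow> real"
  assumes p: "sublinear p"
  shows "\<exists>q. sublinear q \<and> (\<forall>x. q x \<le> p x) \<and> (\<forall>x. q x \<le> p (x + y) - p y)"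
proof -
  define q where "q x = (INF t\<in>{0..}. p (x + t *\<^sub>R y) - t * p y)" for x
  \<comment> \<open>This bound does not depend on \<open>t\<close>, so the real infimum defining
    \<open>q\<close> is a genuine one.\<close>
  have lower: "- p (- x) \<le> p (x + t *\<^sub>R y) - t * p y" if "0 \<le> t" for x t
  proof -
    have "t * p y = p (x + t *\<^sub>R y + - x)"
      using sublinear_scale[OF p that] by simp
    also have "\<dots> \<le> p (x + t *\<^sub>R y) + p (- x)" by (rule sublinear_add[OF p])
    finally show ?thesis by simp
  qed
  have bdd: "bdd_below ((\<lambda>t. p (x + t *\<^sub>R y) - t * p y) ` {0..})" for x
    by (intro bdd_belowI[where m = "- p (- x)"]) (auto intro: lower)
  have q_le: "q x \<le> p (x + t *\<^sub>R y) - t * p y" if "0 \<le> t" for x t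
    unfolding q_def using that by (intro cINF_lower[OF bdd]) auto
  have le_q: "z \<le> q x" if "\<And>t. 0 \<le> t \<Longrightarrow> z \<le> p (x + t *\<^sub>R y) - t * p y" for x z
    unfolding q_def by (rule cINF_greatest) (use that in auto)
  have "sublinear q"
  proof (rule sublinearI)
    fix x z
    \<comment> \<open>Parameters \<open>s\<close> for \<open>x\<close> and \<open>t\<close> for
      \<open>z\<close> combine to the admissible parameter \<open>s + t\<close> for
      \<open>x + z\<close>; the infima over \<open>s\<close> and \<open>t\<close> are then taken one
      after the other.\<close>
    have step: "q (x + z) - (p (z + t *\<^sub>R y) - t * p y) \<le> p (x + s *\<^sub>R y) - s * p y"
      if "0 \<le> s" "0 \<le> t" for s t
    proof -
      have "q (x + z) \<le> p (x + z + (s + t) *\<^sub>R y) - (s + t) * p y"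
        by (rule q_le) (use that in simp)
      also have "p (x + z + (s + t) *\<^sub>R y) = p ((x + s *\<^sub>R y) + (z + t *\<^sub>R y))"
        by (simp add: algebra_simps)
      also have "\<dots> \<le> p (x + s *\<^sub>R y) + p (z + t *\<^sub>R y)" by (rule sublinear_add[OF p])
      finally show ?thesis by (simp add: algebra_simps)
    qed
    have "q (x + z) - (p (z + t *\<^sub>R y) - t * p y) \<le> q x" if "0 \<le> t" for t
      by (rule le_q) (use step that in auto)
    then have "q (x + z) - q x \<le> q z"
      by (intro le_q) (simp add: algebra_simps)
    then show "q (x + z) \<le> q x + q z" by simp
  next
    fix c :: real and x assume c: "0 < c"
    have "q (c *\<^sub>R x) / c \<le> q x"
    proof (rule le_q)
      fix t :: real assume t: "0 \<le> t"
      have "q (c *\<^sub>R x) \<le> p (c *\<^sub>R x + (c * t) *\<^sub>R y) - (c * t) * p y"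
        by (rule q_le) (use c t in simp)
      also have "c *\<^sub>R x + (c * t) *\<^sub>R y = c *\<^sub>R (x + t *\<^sub>R y)" by (simp add: algebra_simps)
      also have "p (c *\<^sub>R (x + t *\<^sub>R y)) = c * p (x + t *\<^sub>R y)" using c by (simp add: sublinear_scale[OF p])
      finally show "q (c *\<^sub>R x) / c \<le> p (x + t *\<^sub>R y) - t * p y" using c by (simp add: field_simps)
    qed
    then show "q (c *\<^sub>R x) \<le> c * q x" using c by (simp add: field_simps)
  next
    have "q 0 \<le> 0" using q_le[of 0 0] sublinear_zero[OF p] by simp
    moreover have "0 \<le> q 0" by (rule le_q) (simp add: sublinear_scale[OF p])
    ultimately show "q 0 = 0" by simp
  qed
  moreover have "q x \<le> p x" for x using q_le[of 0 x] by simp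
  moreover have "q x \<le> p (x + y) - p y" for x using q_le[of 1 x] by simp
  ultimately show ?thesis by blast
qed

text \<open>Provides the lower bounds required by Zorn's lemma. All members stay above
  \<open>- p (- x)\<close> at \<open>x\<close>, so the infimum is finite. Of two members of a chain
  the smaller one lies below both, which yields subadditivity.\<close>

lemma sublinear_INF_chain:
  fixes C :: "('v::real_vector \<Rightarrow> real) set"
  assumes "C \<noteq> {}" and sub: "\<And>q. q \<in> C \<Longrightarrow> sublinear q" and le: "\<And>q. q \<in> C \<Longrightarrow> q \<le> p"
    and chain: "\<And>q r. q \<in> C \<Longrightarrow> r \<in> C \<Longrightarrow> q \<le> r \<or> r \<le> q"
  shows "sublinear (\<lambda>x. INF q\<in>C. q x)" "\<And>q. q \<in> C \<Longrightarrow> (\<lambda>x. INF q\<in>C. q x) \<le> q"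
proof -
  have bdd: "bdd_below ((\<lambda>q. q x) ` C)" for x
  proof (intro bdd_belowI[where m = "- p (- x)"], clarify)
    fix q assume "q \<in> C"
    then show "- p (- x) \<le> q x"
      using sublinear_neg[OF sub, of q x] le[of q] by (auto simp: le_fun_def intro: order_trans[rotated])
  qed
  have lower: "(INF q\<in>C. q x) \<le> q x" if "q \<in> C" for q x
    by (rule cINF_lower[OF bdd that])
  then show "\<And>q. q \<in> C \<Longrightarrow> (\<lambda>x. INF q\<in>C. q x) \<le> q" by (simp add: le_fun_def)
  have greatest: "z \<le> (INF q\<in>C. q x)" if "\<And>q. q \<in> C \<Longrightarrow> z \<le> q x" for z x
    by (rule cINF_greatest) (use that assms(1) in auto)
  show "sublinear (\<lambda>x. INF q\<in>C. q x)"
  proof (rule sublinearI)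
    fix x y
    have step: "(INF q\<in>C. q (x + y)) \<le> q x + r y" if "q \<in> C" "r \<in> C" for q r
    proof -
      obtain s where s: "s \<in> C" "s \<le> q" "s \<le> r"
        using chain[OF \<open>q \<in> C\<close> \<open>r \<in> C\<close>] \<open>q \<in> C\<close> \<open>r \<in> C\<close> by (metis order_refl)
      have "(INF q\<in>C. q (x + y)) \<le> s (x + y)" by (rule lower[OF s(1)])
      also have "\<dots> \<le> s x + s y" by (rule sublinear_add[OF sub[OF s(1)]])
      also have "\<dots> \<le> q x + r y" using s by (intro add_mono) (auto simp: le_fun_def)
      finally show ?thesis .
    qed
    have "(INF q\<in>C. q (x + y)) - r y \<le> (INF q\<in>C. q x)" if "r \<in> C" for r
      by (rule greatest) (use step that in \<open>simp add: algebra_simps\<close>)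
    then have "(INF q\<in>C. q (x + y)) - (INF q\<in>C. q x) \<le> (INF q\<in>C. q y)"
      by (intro greatest) (simp add: algebra_simps)
    then show "(INF q\<in>C. q (x + y)) \<le> (INF q\<in>C. q x) + (INF q\<in>C. q y)" by simp
  next
    fix c :: real and x assume c: "0 < c"
    have "(INF q\<in>C. q (c *\<^sub>R x)) / c \<le> (INF q\<in>C. q x)"
    proof (rule greatest)
      fix q assume "q \<in> C"
      then show "(INF q\<in>C. q (c *\<^sub>R x)) / c \<le> q x"
        using lower[of q "c *\<^sub>R x"] c sublinear_scale[OF sub, of q c x] by (simp add: field_simps)
    qed
    then show "(INF q\<in>C. q (c *\<^sub>R x)) \<le> c * (INF q\<in>C. q x)" using c by (simp add: field_simps)
  next
    have "(\<lambda>q. q 0) ` C = {0}" using sublinear_zero[OF sub] assms(1) by force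
    then show "(INF q\<in>C. q 0) = 0" by simp
  qed
qed

text \<open>
  Linear functionals are exactly the minimal sublinear ones, so Zorn's lemma can be applied to
  sublinear functionals on the whole space and no partially defined functionals are needed.
\<close>

lemma minimal_sublinear_exists:
  fixes p :: "'v::real_vector \<Rightarrow> real"
  assumes "sublinear p"
  shows "\<exists>m. sublinear m \<and> m \<le> p \<and> (\<forall>q. sublinear q \<and> q \<le> m \<longrightarrow> q = m)"
proof -
  let ?A = "{q. sublinear q \<and> q \<le> p}"
  have "\<exists>m\<in>?A. \<forall>a\<in>?A. m \<ge> a \<longrightarrow> a = m"
  proof (rule predicate_Zorn)
    show "partial_order_on ?A (relation_of (\<ge>) ?A)"
      by (auto simp: partial_order_on_def preorder_on_def refl_on_def trans_def antisym_def relation_of_def)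
  next
    fix C assume C: "C \<in> Chains (relation_of (\<ge>) ?A)"
    then have CA: "C \<subseteq> ?A" and ch: "\<And>q r. q \<in> C \<Longrightarrow> r \<in> C \<Longrightarrow> q \<le> r \<or> r \<le> q"
      by (auto simp: Chains_def relation_of_def)
    show "\<exists>u\<in>?A. \<forall>a\<in>C. a \<ge> u"
    proof (cases "C = {}")
      case True
      with assms show ?thesis by auto
    next
      case False
      note * = sublinear_INF_chain[OF this _ _ ch, of p]
      have "sublinear (\<lambda>x. INF q\<in>C. q x)" by (rule *) (use CA in auto)
      moreover have "(\<lambda>x. INF q\<in>C. q x) \<le> q" if "q \<in> C" for q by (rule *) (use CA that in auto)
      moreover from this False CA have "(\<lambda>x. INF q\<in>C. q x) \<le> p" by (blast intro: order_trans)
      ultimately show ?thesis by blast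
    qed
  qed
  then show ?thesis by (blast intro: order_trans)
qed

text \<open>Tilting a minimal functional along \<open>y\<close> cannot change it, and the second
  bound of the tilt then reads as superadditivity.\<close>

lemma minimal_sublinear_linear:
  fixes m :: "'v::real_vector \<Rightarrow> real"
  assumes m: "sublinear m" and min: "\<And>q. sublinear q \<Longrightarrow> q \<le> m \<Longrightarrow> q = m"
  shows "linear m"
proof -
  have super: "m x + m y \<le> m (x + y)" for x y
  proof -
    obtain q where "sublinear q" "\<forall>x. q x \<le> m x" and q: "\<forall>x. q x \<le> m (x + y) - m y"
      using sublinear_tilt[OF m] by blast
    then have "q = m" by (intro min) (auto simp: le_fun_def)
    with q have "m x \<le> m (x + y) - m y" by auto
    then show ?thesis by simp
  qed
  have add: "m (x + y) = m x + m y" for x y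
    using super[of x y] sublinear_add[OF m, of x y] by simp
  have neg: "m (- x) = - m x" for x
    using add[of x "- x"] sublinear_zero[OF m] by simp
  show ?thesis
  proof (rule linearI)
    fix c :: real and x
    show "m (c *\<^sub>R x) = c *\<^sub>R m x"
    proof (cases "0 \<le> c")
      case False
      then have "m ((- c) *\<^sub>R x) = (- c) * m x" by (intro sublinear_scale[OF m]) auto
      then show ?thesis using neg[of "c *\<^sub>R x"] by simp
    qed (simp add: sublinear_scale[OF m])
  qed (rule add)
qed

text \<open>Tilting along \<open>a\<close> before passing to a minimal functional forces
  \<open>L (- a) \<le> - p a\<close>, which together with domination fixes the value at
  \<open>a\<close>.\<close>

theorem hahn_banach_sublinear:
  fixes p :: "'v::real_vector \<Rightarrow> real"
  assumes p: "sublinear p"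
  shows "\<exists>L. linear L \<and> (\<forall>x. L x \<le> p x) \<and> L a = p a"
proof -
  obtain q where q: "sublinear q" "\<forall>x. q x \<le> p x" "\<forall>x. q x \<le> p (x + a) - p a"
    using sublinear_tilt[OF p] by blast
  obtain L where L: "sublinear L" "L \<le> q" "\<And>r. sublinear r \<Longrightarrow> r \<le> L \<Longrightarrow> r = L"
    using minimal_sublinear_exists[OF q(1)] by blast
  have lin: "linear L" by (rule minimal_sublinear_linear) (use L in auto)
  have le: "L x \<le> p x" for x using L(2) q(2) by (auto simp: le_fun_def intro: order_trans)
  have "L (- a) \<le> - p a"
    using L(2) q(3)[rule_format, of "- a"] sublinear_zero[OF p]
    by (auto simp: le_fun_def intro: order_trans)
  then have "p a \<le> L a" using linear_neg[OF lin, of a] by simp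
  then have "L a = p a" using le[of a] by simp
  with lin le show ?thesis by blast
qed

text \<open>The preceding theorem is applied to the quotient functional of \<open>p\<close> modulo
  \<open>U\<close>. It is at most 0 on \<open>U\<close>, so \<open>L\<close> is at most 0 at both
  \<open>u\<close> and \<open>- u\<close>, and at \<open>a\<close> it is at least \<open>d\<close>.
  Nonnegativity on \<open>U\<close> keeps the infimum finite and its value at 0 equal to 0.\<close>

theorem hahn_banach_annihilator:
  fixes p :: "'v::real_vector \<Rightarrow> real"
  assumes p: "sublinear p" and U: "subspace U"
    and nonneg: "\<And>u. u \<in> U \<Longrightarrow> 0 \<le> p u" and d: "\<And>u. u \<in> U \<Longrightarrow> d \<le> p (a - u)"
  shows "\<exists>L. linear L \<and> (\<forall>x. L x \<le> p x) \<and> (\<forall>u\<in>U. L u = 0) \<and> d \<le> L a"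
proof -
  define q where "q x = (INF u\<in>U. p (x - u))" for x
  have U0: "0 \<in> U" by (rule subspace_0[OF U])
  have lower: "- p (- x) \<le> p (x - u)" if "u \<in> U" for x u
  proof -
    have "0 \<le> p (x - u + - x)" using nonneg[OF subspace_neg[OF U that]] by simp
    also have "\<dots> \<le> p (x - u) + p (- x)" by (rule sublinear_add[OF p])
    finally show ?thesis by simp
  qed
  have q_le: "q x \<le> p (x - u)" if "u \<in> U" for x u
    unfolding q_def using that
    by (intro cINF_lower bdd_belowI[where m = "- p (- x)"]) (auto intro: lower)
  have le_q: "z \<le> q x" if "\<And>u. u \<in> U \<Longrightarrow> z \<le> p (x - u)" for x z
    unfolding q_def by (rule cINF_greatest) (use that U0 in auto)
  have "sublinear q"
  proof (rule sublinearI)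
    fix x y
    have step: "q (x + y) - p (y - v) \<le> p (x - u)" if "u \<in> U" "v \<in> U" for u v
    proof -
      have "q (x + y) \<le> p (x + y - (u + v))" by (rule q_le) (use that U in \<open>simp add: subspace_add\<close>)
      also have "x + y - (u + v) = (x - u) + (y - v)" by simp
      also have "p \<dots> \<le> p (x - u) + p (y - v)" by (rule sublinear_add[OF p])
      finally show ?thesis by simp
    qed
    have "q (x + y) - p (y - v) \<le> q x" if "v \<in> U" for v
      by (rule le_q) (use step that in auto)
    then have "q (x + y) - q x \<le> q y" by (intro le_q) (simp add: algebra_simps)
    then show "q (x + y) \<le> q x + q y" by simp
  next
    fix c :: real and x assume c: "0 < c"
    have "q (c *\<^sub>R x) / c \<le> q x"
    proof (rule le_q)
      fix u assume "u \<in> U"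
      then have "q (c *\<^sub>R x) \<le> p (c *\<^sub>R x - c *\<^sub>R u)" by (intro q_le subspace_scale[OF U])
      also have "\<dots> = c * p (x - u)"
        using c sublinear_scale[OF p, of c "x - u"] by (simp add: scaleR_diff_right)
      finally show "q (c *\<^sub>R x) / c \<le> p (x - u)" using c by (simp add: field_simps)
    qed
    then show "q (c *\<^sub>R x) \<le> c * q x" using c by (simp add: field_simps)
  next
    have "q 0 \<le> 0" using q_le[OF U0, of 0] sublinear_zero[OF p] by simp
    moreover have "0 \<le> q 0" by (rule le_q) (simp add: nonneg subspace_neg[OF U])
    ultimately show "q 0 = 0" by simp
  qed
  then obtain L where L: "linear L" "\<And>x. L x \<le> q x" "L a = q a"
    using hahn_banach_sublinear by blast
  have "L u \<le> 0" if "u \<in> U" for u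
    using L(2)[of u] q_le[OF that, of u] sublinear_zero[OF p] by simp
  then have "L u = 0" if "u \<in> U" for u
    using that subspace_neg[OF U that] linear_neg[OF L(1), of u] by (smt (verit))
  moreover have "L x \<le> p x" for x using L(2)[of x] q_le[OF U0, of x] by simp
  moreover have "d \<le> L a" unfolding L(3) by (rule le_q) (rule d)
  ultimately show ?thesis using L(1) by blast
qed

section \<open>Riesz representation on zero-dimensional compact spaces\<close>

lemma continuous_on_indicator_clopen:
  fixes C :: "'a::topological_space set"
  assumes "open C" "closed C"
  shows "continuous_on UNIV (indicator C :: 'a \<Rightarrow> real)"
proof (rule continuous_on_open_vimage[OF open_UNIV, THEN iffD2], intro allI impI)
  fix B :: "real set"
  have "indicator C -` B = (if 0 \<in> B then - C else {}) \<union> (if 1 \<in> B then C else {})"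
    by (auto simp: indicator_def of_bool_def split: if_splits)
  moreover have "open (- C)" using assms by (simp add: open_closed)
  ultimately show "open (indicator C -` B \<inter> UNIV)" using assms by auto
qed

lemma compact_apply_Bcontfun:
  fixes f :: "'a::topological_space \<Rightarrow> real"
  assumes "compact (UNIV :: 'a set)" "continuous_on UNIV f"
  shows "apply_bcontfun (Bcontfun f) = f"
  using compact_imp_bounded[OF compact_continuous_image[OF assms(2,1)]] assms(2)
  by (intro Bcontfun_inverse) (simp add: bcontfun_def)

lemma apply_bcontfun_sum: "apply_bcontfun (sum f S) x = (\<Sum>i\<in>S. apply_bcontfun (f i) x)"
  by (induction S rule: infinite_finite_induct) auto

text \<open>An open set is the union of the clopen sets inside it, and by the Lindelof property
  countably many of them suffice.\<close>

lemma sigma_sets_clopen: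
  assumes base: "\<And>U (x :: 'a::second_countable_topology). open U \<Longrightarrow> x \<in> U \<Longrightarrow> \<exists>C. open C \<and> closed C \<and> x \<in> C \<and> C \<subseteq> U"
  shows "sigma_sets UNIV {C :: 'a set. open C \<and> closed C} = sets borel"
proof
  have "{C :: 'a set. open C \<and> closed C} \<subseteq> sets borel" by auto
  from sets.sigma_sets_subset[OF this]
  show "sigma_sets UNIV {C :: 'a set. open C \<and> closed C} \<subseteq> sets borel" by simp
next
  have "U \<in> sigma_sets UNIV {C. open C \<and> closed C}" if "open U" for U :: "'a set"
  proof -
    let ?F = "{C. open C \<and> closed C \<and> C \<subseteq> U}"
    obtain F where F: "F \<subseteq> ?F" "countable F" "\<Union>F = \<Union>?F"
      using Lindelof[of ?F] by blast
    have "\<Union>?F = U" using base[OF that] by blast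
    moreover have "\<Union>F \<in> sigma_sets UNIV {C. open C \<and> closed C}"
      by (rule sigma_sets_UNION[OF F(2)]) (use F(1) in auto)
    ultimately show ?thesis using F(3) by simp
  qed
  then have "sigma_sets UNIV (Collect open) \<subseteq> sigma_sets UNIV {C :: 'a set. open C \<and> closed C}"
    by (intro sigma_sets_mono) auto
  then show "sets borel \<subseteq> sigma_sets UNIV {C :: 'a set. open C \<and> closed C}"
    by (simp add: borel_def)
qed

text \<open>Caratheodory's extension theorem needs continuity at the empty set. Here it is
  automatic: by compactness a decreasing sequence of clopen sets with empty intersection is
  eventually empty.\<close>

lemma clopen_content_extends:
  fixes f :: "'a::second_countable_topology set \<Rightarrow> real"
  assumes compact: "compact (UNIV :: 'a set)"
    and base: "\<And>U x :: 'a. open U \<Longrightarrow> x \<in> U \<Longrightarrow> \<exists>C. open C \<and> closed C \<and> x \<in> C \<and> C \<subseteq> U"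
    and nonneg: "\<And>C. open C \<Longrightarrow> closed C \<Longrightarrow> 0 \<le> f C" and empty: "f {} = 0"
    and add: "\<And>C D. open C \<Longrightarrow> closed C \<Longrightarrow> open D \<Longrightarrow> closed D \<Longrightarrow> C \<inter> D = {} \<Longrightarrow> f (C \<union> D) = f C + f D"
  shows "\<exists>M. finite_measure M \<and> sets M = sets borel \<and>
    (\<forall>C. open C \<longrightarrow> closed C \<longrightarrow> measure M C = f C)"
proof -
  let ?CL = "{C :: 'a set. open C \<and> closed C}"
  interpret algebra UNIV ?CL
    by (auto simp: algebra_iff_Un Compl_eq_Diff_UNIV[symmetric] open_closed)
  have "\<exists>\<mu>. (\<forall>C\<in>?CL. \<mu> C = ennreal (f C)) \<and> measure_space UNIV (sigma_sets UNIV ?CL) \<mu>"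
  proof (rule caratheodory_empty_continuous)
    show "positive ?CL (\<lambda>C. ennreal (f C))" by (simp add: positive_def empty)
    show "additive ?CL (\<lambda>C. ennreal (f C))"
      by (auto simp: additive_def add ennreal_plus nonneg)
  next
    fix A :: "nat \<Rightarrow> 'a set"
    assume A: "range A \<subseteq> ?CL" "decseq A" "(\<Inter>i. A i) = {}"
    have "open (- A n)" for n using A(1) by (auto simp: range_subsetD)
    moreover have "UNIV \<subseteq> (\<Union>n. - A n)" using A(3) by blast
    ultimately obtain N where N: "finite N" "UNIV \<subseteq> (\<Union>n\<in>N. - A n)"
      by (rule compactE_image[OF compact])
    \<comment> \<open>The set of index \<open>Max N\<close> is contained in every \<open>A n\<close>
      with \<open>n\<close> in \<open>N\<close>, whereas the complements of these sets cover the
      space; hence it is empty.\<close>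
    have "A (Max N) \<subseteq> A n" if "n \<in> N" for n
      using A(2) N(1) that by (simp add: decseq_def)
    with N(2) have "\<exists>n. A n = {}" by blast
    then obtain n where "A n = {}" by blast
    then have "A m = {}" if "n \<le> m" for m using A(2) that by (auto simp: decseq_def)
    then have "\<forall>\<^sub>F m in sequentially. ennreal (f (A m)) = 0"
      by (intro eventually_sequentiallyI[of n]) (simp add: empty)
    then show "(\<lambda>i. ennreal (f (A i))) \<longlonglongrightarrow> 0" by (rule tendsto_eventually)
  qed simp
  then obtain \<mu> where \<mu>: "\<And>C. C \<in> ?CL \<Longrightarrow> \<mu> C = ennreal (f C)"
    "measure_space UNIV (sigma_sets UNIV ?CL) \<mu>" by blast
  define M where "M = measure_of UNIV (sigma_sets UNIV ?CL) \<mu>"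
  have "sets M = sigma_sets UNIV ?CL"
    unfolding M_def by (simp add: sigma_sets_sigma_sets_eq)
  then have sets: "sets M = sets borel" using sigma_sets_clopen[OF base] by simp
  have emeasure: "emeasure M C = ennreal (f C)" if "C \<in> ?CL" for C
    unfolding M_def using \<mu>(2) that
    by (subst emeasure_measure_of_sigma) (auto simp: measure_space_def \<mu>(1))
  have "space M = UNIV" using sets_eq_imp_space_eq[OF sets] by simp
  then have "finite_measure M" by (intro finite_measureI) (simp add: emeasure)
  moreover have "measure M C = f C" if "open C" "closed C" for C
    using emeasure[of C] that nonneg by (simp add: measure_def)
  ultimately show ?thesis using sets by blast
qed

text \<open>The measure extends the values of \<open>L\<close> on indicators of clopen sets. The
  representation then holds for continuous functions of finite range by linearity, and for all
  others by uniform approximation, where monotonicity of \<open>L\<close> controls the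
  error.\<close>

theorem riesz_zero_dimensional:
  fixes L :: "('a::{second_countable_topology,t2_space} \<Rightarrow>\<^sub>C real) \<Rightarrow> real"
  assumes compact: "compact (UNIV :: 'a set)"
    and base: "\<And>U x :: 'a. open U \<Longrightarrow> x \<in> U \<Longrightarrow> \<exists>C. open C \<and> closed C \<and> x \<in> C \<and> C \<subseteq> U"
    and L: "linear L" and pos: "\<And>g. (\<And>x. 0 \<le> apply_bcontfun g x) \<Longrightarrow> 0 \<le> L g"
  shows "\<exists>M. finite_measure M \<and> sets M = sets borel \<and> (\<forall>g. L g = (\<integral>x. apply_bcontfun g x \<partial>M))"
proof -
  define ind :: "'a set \<Rightarrow> ('a \<Rightarrow>\<^sub>C real)" where "ind C = Bcontfun (indicator C)" for C
  have ind: "apply_bcontfun (ind C) = indicator C" if "open C" "closed C" for C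
    unfolding ind_def using that
    by (intro compact_apply_Bcontfun compact continuous_on_indicator_clopen)
  have "\<exists>M. finite_measure M \<and> sets M = sets borel \<and>
      (\<forall>C. open C \<longrightarrow> closed C \<longrightarrow> measure M C = L (ind C))"
  proof (rule clopen_content_extends[OF compact])
    fix U and x :: 'a assume "open U" "x \<in> U"
    then show "\<exists>C. open C \<and> closed C \<and> x \<in> C \<and> C \<subseteq> U" by (rule base)
  next
    fix C :: "'a set" assume "open C" "closed C"
    then show "0 \<le> L (ind C)" by (intro pos) (simp add: ind)
  next
    fix C D :: "'a set"
    assume "open C" "closed C" "open D" "closed D" "C \<inter> D = {}"
    then have "ind (C \<union> D) = ind C + ind D"
      by (intro bcontfun_eqI) (auto simp: ind open_Un closed_Un indicator_def)
    then show "L (ind (C \<union> D)) = L (ind C) + L (ind D)" using linear_add[OF L] by simp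
  next
    have "ind {} = 0" by (intro bcontfun_eqI) (simp add: ind)
    then show "L (ind {}) = 0" using linear_0[OF L] by simp
  qed
  then obtain M where M: "finite_measure M" "sets M = sets borel"
    and "\<forall>C. open C \<longrightarrow> closed C \<longrightarrow> measure M C = L (ind C)" by (elim exE conjE)
  then have meas: "measure M C = L (ind C)" if "open C" "closed C" for C using that by simp
  interpret finite_measure M by (rule M(1))
  have space: "space M = UNIV" using sets_eq_imp_space_eq[OF M(2)] by simp
  have measurable: "apply_bcontfun g \<in> borel_measurable M" for g :: "'a \<Rightarrow>\<^sub>C real"
    by (subst measurable_cong_sets[OF M(2) refl])
      (intro borel_measurable_continuous_onI continuous_on_apply_bcontfun)
  have integrable: "integrable M (apply_bcontfun g)" for g :: "'a \<Rightarrow>\<^sub>C real"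
    using norm_bounded[of g] measurable
    by (intro integrable_const_bound[where B = "norm g"] AE_I2) simp_all
  have finite_range: "L g = (\<integral>x. apply_bcontfun g x \<partial>M)" if fin: "finite (range (apply_bcontfun g))" for g
  proof -
    define C where "C v = apply_bcontfun g -` {v}" for v
    have closed: "closed (C v)" for v
      unfolding C_def by (intro closed_vimage closed_singleton continuous_on_apply_bcontfun)
    \<comment> \<open>The complement of a level set is the union of the other level sets, which are
      closed and finite in number.\<close>
    have "open (C v)" for v
    proof -
      have "C v = - (\<Union>w\<in>range (apply_bcontfun g) - {v}. C w)" by (auto simp: C_def)
      moreover have "closed (\<Union>w\<in>range (apply_bcontfun g) - {v}. C w)"
        using fin closed by (intro closed_UN) auto
      ultimately show ?thesis by (simp add: open_closed)
    qed
    note clopen = this closed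
    have g: "apply_bcontfun g x = (\<Sum>v\<in>range (apply_bcontfun g). v * indicator (C v) x)" for x
    proof -
      have "(\<Sum>v\<in>range (apply_bcontfun g). v * indicator (C v) x) =
          (\<Sum>v\<in>range (apply_bcontfun g). if v = apply_bcontfun g x then v else 0)"
        by (intro sum.cong) (auto simp: C_def indicator_def)
      also have "\<dots> = apply_bcontfun g x" using fin by (subst sum.delta) auto
      finally show ?thesis by simp
    qed
    have "g = (\<Sum>v\<in>range (apply_bcontfun g). v *\<^sub>R ind (C v))" (is "g = ?s")
    proof (rule bcontfun_eqI)
      have "apply_bcontfun ?s x = (\<Sum>v\<in>range (apply_bcontfun g). v * indicator (C v) x)" for x
        unfolding apply_bcontfun_sum by (intro sum.cong) (simp_all add: ind clopen)
      then show "apply_bcontfun g x = apply_bcontfun ?s x" for x by (simp only: g[symmetric])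
    qed
    then have "L g = L ?s" by (rule arg_cong)
    also have "\<dots> = (\<Sum>v\<in>range (apply_bcontfun g). v * measure M (C v))"
      by (simp add: linear_sum[OF L] linear_scale[OF L] meas clopen)
    also have "\<dots> = (\<integral>x. (\<Sum>v\<in>range (apply_bcontfun g). v * indicator (C v) x) \<partial>M)"
    proof (subst Bochner_Integration.integral_sum)
      have "C v \<in> sets M" for v unfolding M(2) by (rule borel_closed[OF closed])
      then have "integrable M (indicator (C v) :: 'a \<Rightarrow> real)" for v
        by (intro integrable_real_indicator) (simp_all add: less_top[symmetric])
      then show "integrable M (\<lambda>x. v * indicator (C v) x)" for v by simp
    qed (simp add: space)
    also have "\<dots> = (\<integral>x. apply_bcontfun g x \<partial>M)" by (simp only: g[symmetric])
    finally show ?thesis .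
  qed
  have approx: "\<exists>h. finite (range (apply_bcontfun h)) \<and> (\<forall>x. \<bar>apply_bcontfun g x - apply_bcontfun h x\<bar> < e)"
    if e: "0 < e" for g :: "'a \<Rightarrow>\<^sub>C real" and e
  proof -
    have "\<exists>h. (continuous_on UNIV h \<and> finite (range h)) \<and> (\<forall>x\<in>UNIV. \<bar>apply_bcontfun g x - h x\<bar> < e)"
    \<comment> \<open>Continuous functions of finite range form an algebra. Indicators of clopen
      sets belong to it and separate points.\<close>
    proof (rule Stone_Weierstrass_HOL[where P = "\<lambda>h. continuous_on UNIV h \<and> finite (range h)", OF compact])
      fix f h :: "'a \<Rightarrow> real"
      assume fh: "(continuous_on UNIV f \<and> finite (range f)) \<and> (continuous_on UNIV h \<and> finite (range h))"
      then have fin: "finite (range f \<times> range h)" by simp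
      have "finite (range (\<lambda>x. f x + h x))"
        by (rule finite_surj[OF fin, of _ "\<lambda>(a, b). a + b"]) auto
      moreover have "finite (range (\<lambda>x. f x * h x))"
        by (rule finite_surj[OF fin, of _ "\<lambda>(a, b). a * b"]) auto
      ultimately show "continuous_on UNIV (\<lambda>x. f x + h x) \<and> finite (range (\<lambda>x. f x + h x))"
        "continuous_on UNIV (\<lambda>x. f x * h x) \<and> finite (range (\<lambda>x. f x * h x))"
        using fh by (simp_all add: continuous_on_add continuous_on_mult)
    next
      fix x y :: 'a
      assume "x \<in> UNIV \<and> y \<in> UNIV \<and> x \<noteq> y"
      then obtain U where "open U" "x \<in> U" "y \<notin> U" using separation_t1[of x y] by blast
      then obtain C where C: "open C" "closed C" "x \<in> C" "y \<notin> C" using base by blast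
      have "range (indicator C :: 'a \<Rightarrow> real) \<subseteq> {0, 1}" by (auto simp: indicator_def)
      then have "finite (range (indicator C :: 'a \<Rightarrow> real))" by (rule finite_subset) simp
      with C show "\<exists>f. (continuous_on UNIV f \<and> finite (range f)) \<and> f x \<noteq> (f y :: real)"
        by (intro exI[of _ "indicator C"]) (auto intro: continuous_on_indicator_clopen)
    qed (use e in auto)
    then obtain h where "continuous_on UNIV h" "finite (range h)" "\<And>x. \<bar>apply_bcontfun g x - h x\<bar> < e"
      by auto
    then show ?thesis by (intro exI[of _ "Bcontfun h"]) (simp add: compact_apply_Bcontfun[OF compact])
  qed
  define one where "one = (const_bcontfun 1 :: 'a \<Rightarrow>\<^sub>C real)"
  have one: "apply_bcontfun one x = 1" for x by (simp add: one_def)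
  have L_le: "L f \<le> L g" if "\<And>x. apply_bcontfun f x \<le> apply_bcontfun g x" for f g
    using pos[of "g - f"] that linear_diff[OF L] by simp
  have "\<bar>L g - (\<integral>x. apply_bcontfun g x \<partial>M)\<bar> \<le> 0 + e" if e: "0 < e" for g e
  proof -
    \<comment> \<open>\<open>L one\<close> is the total mass of \<open>M\<close>, so replacing
      \<open>g\<close> by \<open>h\<close> costs at most \<open>e' * L one\<close> on each side. The
      added 1 avoids division by zero.\<close>
    define e' where "e' = e / (2 * (L one + 1))"
    have "0 \<le> L one" by (rule pos) (simp add: one)
    then have e': "0 < e'" "2 * (e' * L one) \<le> e" using e by (auto simp: e'_def field_simps)
    obtain h where h: "finite (range (apply_bcontfun h))"
      and gh: "\<And>x. \<bar>apply_bcontfun g x - apply_bcontfun h x\<bar> < e'"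
      using approx[OF e'(1)] by blast
    have M_one: "measure M UNIV = L one"
    proof -
      have "ind UNIV = one" by (intro bcontfun_eqI) (simp add: ind one)
      then show ?thesis using meas[of UNIV] by simp
    qed
    have "L g \<le> L (h + e' *\<^sub>R one)" "L h \<le> L (g + e' *\<^sub>R one)"
      using gh by (auto intro!: L_le simp: one abs_less_iff algebra_simps less_imp_le)
    then have 1: "\<bar>L g - L h\<bar> \<le> e' * L one"
      by (simp add: linear_add[OF L] linear_scale[OF L])
    have "\<bar>(\<integral>x. apply_bcontfun g x \<partial>M) - (\<integral>x. apply_bcontfun h x \<partial>M)\<bar> =
        \<bar>\<integral>x. apply_bcontfun g x - apply_bcontfun h x \<partial>M\<bar>"
      using integrable by simp
    also have "\<dots> \<le> (\<integral>x. \<bar>apply_bcontfun g x - apply_bcontfun h x\<bar> \<partial>M)"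
      by (rule integral_abs_bound)
    also have "\<dots> \<le> (\<integral>x. e' \<partial>M)"
      by (intro integral_mono) (use gh integrable in \<open>auto intro: less_imp_le\<close>)
    also have "\<dots> = e' * L one" using space by (simp add: M_one)
    finally show ?thesis using 1 e' finite_range[OF h] by linarith
  qed
  then have "L g = (\<integral>x. apply_bcontfun g x \<partial>M)" for g
    using field_le_epsilon[of "\<bar>L g - (\<integral>x. apply_bcontfun g x \<partial>M)\<bar>" 0] by simp
  with M show ?thesis by blast
qed

section \<open>The infinite product of circles as an image of the Cantor space\<close>

text \<open>Compact sets in a Hausdorff space are closed, so neighbourhoods of \<open>None\<close>
  are described by compactness of the complement alone.\<close>

lemma open_option_iff:
  fixes U :: "'a::t2_space option set"
  shows "open U \<longleftrightarrow> (\<exists>V. open V \<and> U = Some ` V) \<or>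
    (\<exists>C. compact C \<and> U = insert None (Some ` (- C)))"
  by (auto simp: open_option_def openin_Alexandroff_compactification Compl_eq_Diff_UNIV
      intro: compact_imp_closed)

lemma open_vimage_Some:
  fixes U :: "'a::t2_space option set"
  assumes "open U"
  shows "open (Some -` U)"
proof -
  have "Some -` Some ` V = V" "Some -` insert None (Some ` V) = V" for V :: "'a set" by auto
  with assms show ?thesis by (auto simp: open_option_iff compact_imp_closed open_Compl)
qed

text \<open>Every compact set lies in a closed ball of integer radius about 0, so the complements of
  these balls give a countable neighbourhood base at \<open>None\<close>. Second countability passes
  to the product and links its Borel sets to the cylinder sets.\<close>

instance option :: (euclidean_space) second_countable_topology
proof
  obtain B :: "'a set set" where B: "countable B" "topological_basis B"
    using ex_countable_basis by blast
  let ?B = "(`) Some ` B \<union> range (\<lambda>n::nat. insert None (Some ` (- cball 0 (real n))))"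
  have "topological_basis ?B"
  proof (rule topological_basisI)
    fix U :: "'a option set"
    assume "U \<in> ?B"
    then show "open U"
    proof (elim UnE imageE)
      fix b assume "U = Some ` b" "b \<in> B"
      then show ?thesis
        unfolding open_option_iff
        by (intro disjI1 exI[of _ b] conjI topological_basis_open[OF B(2)])
    next
      fix n :: nat assume "U = insert None (Some ` (- cball 0 (real n)))"
      then show ?thesis
        unfolding open_option_iff by (intro disjI2 exI[of _ "cball 0 (real n)"] conjI compact_cball)
    qed
  next
    fix U and x :: "'a option"
    assume U: "open U" "x \<in> U"
    show "\<exists>b\<in>?B. x \<in> b \<and> b \<subseteq> U"
    proof (cases x)
      case None
      then obtain C where C: "compact C" "U = insert None (Some ` (- C))"
        using U unfolding open_option_iff by blast
      from compact_imp_bounded[OF this(1)] obtain r where r: "\<forall>x\<in>C. norm x \<le> r"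
        unfolding bounded_iff by (elim exE)
      obtain n :: nat where n: "r \<le> real n" using real_arch_simple[of r] by (elim exE)
      have "C \<subseteq> cball 0 (real n)"
      proof
        fix y assume "y \<in> C"
        with r have "norm y \<le> r" by (rule bspec)
        with n show "y \<in> cball 0 (real n)" by simp
      qed
      then have "Some ` (- cball 0 (real n)) \<subseteq> Some ` (- C)" by (intro image_mono) simp
      then have "insert None (Some ` (- cball 0 (real n))) \<subseteq> U"
        unfolding C(2) by blast
      then show ?thesis
        unfolding None by (intro bexI[OF _ UnI2[OF rangeI]] conjI insertI1)
    next
      case (Some a)
      with U(2) have "a \<in> Some -` U" by simp
      then obtain b where b: "b \<in> B" "a \<in> b" "b \<subseteq> Some -` U"
        by (rule topological_basisE[OF B(2) open_vimage_Some[OF U(1)]])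
      then have "Some ` b \<subseteq> U" by (simp add: image_subset_iff_subset_vimage)
      then show ?thesis
        unfolding Some using b(1,2) by (intro bexI[OF _ UnI1[OF imageI]] conjI imageI)
    qed
  qed
  moreover have "countable ?B" using B(1) by simp
  ultimately show "\<exists>B :: 'a option set set. countable B \<and> open = generate_topology B"
    using topological_basis_imp_subbasis by blast
qed

text \<open>The product has a countable base of boxes that restrict finitely many coordinates, that
  is, of cylinder sets; hence every open set is a countable union of cylinder sets.\<close>

lemma borel_eq_cylinder_sets:
  "sigma_sets UNIV (cylinder_sets :: (nat \<Rightarrow> 'a::second_countable_topology) set set) = sets borel"
proof
  have "C \<in> sets borel" if *: "C \<in> cylinder_sets" for C :: "(nat \<Rightarrow> 'a) set"
  proof -
    obtain I U where C: "C = {\<omega>. \<forall>i\<in>I. \<omega> i \<in> U i}" "finite I" "\<forall>i\<in>I. open (U i)"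
      using * by (auto simp: cylinder_sets_def)
    have "C = (\<Inter>i\<in>I. (\<lambda>\<omega>. \<omega> i) -` U i)" using C(1) by auto
    also have "open \<dots>"
      by (intro open_INT ballI open_vimage continuous_on_product_coordinates C(2) C(3)[rule_format])
    finally show ?thesis by simp
  qed
  then have "cylinder_sets \<subseteq> sets (borel :: (nat \<Rightarrow> 'a) measure)" by blast
  from sets.sigma_sets_subset[OF this]
  show "sigma_sets UNIV (cylinder_sets :: (nat \<Rightarrow> 'a) set set) \<subseteq> sets borel" by simp
next
  from product_topology_countable_basis
  obtain K :: "(nat \<Rightarrow> 'a) set set" where K: "topological_basis K" "countable K"
    "\<forall>k\<in>K. \<exists>X. k = Pi\<^sub>E UNIV X \<and> (\<forall>i. open (X i)) \<and> finite {i. X i \<noteq> UNIV}"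
    by (elim exE conjE)
  have cyl: "K \<subseteq> cylinder_sets"
  proof
    fix k assume "k \<in> K"
    with K(3) have "\<exists>X. k = Pi\<^sub>E UNIV X \<and> (\<forall>i. open (X i)) \<and> finite {i. X i \<noteq> UNIV}" by (rule bspec)
    then obtain X where X: "k = Pi\<^sub>E UNIV X" "\<forall>i. open (X i)" "finite {i. X i \<noteq> UNIV}"
      by (elim exE conjE)
    have "(\<forall>i. y i \<in> X i) \<longleftrightarrow> (\<forall>i. X i \<noteq> UNIV \<longrightarrow> y i \<in> X i)" for y by (metis UNIV_I)
    then have "k = {\<omega>. \<forall>i\<in>{i. X i \<noteq> UNIV}. \<omega> i \<in> X i}"
      by (simp add: X(1) set_eq_iff PiE_UNIV_domain Pi_iff)
    with X(2,3) show "k \<in> cylinder_sets"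
      unfolding cylinder_sets_def by (intro CollectI exI[of _ "{i. X i \<noteq> UNIV}"] exI[of _ X]) simp
  qed
  have "U \<in> sigma_sets UNIV cylinder_sets" if U: "open U" for U :: "(nat \<Rightarrow> 'a) set"
  proof -
    have "\<exists>F\<subseteq>K. \<Union>F = U" using K(1) U by (simp add: topological_basis_def)
    then obtain F where F: "F \<subseteq> K" "\<Union>F = U" by (elim exE conjE)
    have "\<Union>F \<in> sigma_sets UNIV cylinder_sets"
      using F(1) cyl countable_subset[OF F(1) K(2)] by (intro sigma_sets_UNION) auto
    with F(2) show ?thesis by simp
  qed
  then have "sigma_sets UNIV (Collect open) \<subseteq> sigma_sets UNIV (cylinder_sets :: (nat \<Rightarrow> 'a) set set)"
    by (intro sigma_sets_mono) auto
  then show "sets borel \<subseteq> sigma_sets UNIV (cylinder_sets :: (nat \<Rightarrow> 'a) set set)"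
    by (simp add: borel_def)
qed

section \<open>The Cantor space as the product of discrete two-point spaces\<close>

lemma compact_cantor: "compact (UNIV :: (nat \<Rightarrow> bool discrete) set)"
proof -
  have "b \<in> discrete ` UNIV" for b :: "bool discrete"
    by (rule image_eqI[of _ _ "of_discrete b"]) (simp_all add: of_discrete_inverse)
  then have "finite (UNIV :: bool discrete set)"
    by (intro finite_subset[of UNIV "discrete ` UNIV"] subsetI) simp_all
  then have "compact_space (euclidean :: bool discrete topology)"
    by (simp add: compact_space_def finite_imp_compact)
  then have "compact_space (product_topology (\<lambda>_::nat. (euclidean :: bool discrete topology)) UNIV)"
    by (simp add: compact_space_product_topology)
  then show ?thesis by (simp add: euclidean_product_topology compact_space_def)
qed

text \<open>A basic box restricts finitely many coordinates, each to a set that is clopen because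
  the factor is discrete; so the box itself is clopen.\<close>

lemma cantor_clopen_base:
  fixes x :: "nat \<Rightarrow> 'a discrete"
  assumes "open U" "x \<in> U"
  shows "\<exists>C. open C \<and> closed C \<and> x \<in> C \<and> C \<subseteq> U"
proof -
  have "openin (product_topology (\<lambda>_. euclidean) UNIV) U"
    using assms(1) by (simp add: open_fun_def)
  from product_topology_open_contains_basis[OF this assms(2)]
  obtain X where X: "x \<in> Pi\<^sub>E UNIV X" "finite {i. X i \<noteq> UNIV}" "Pi\<^sub>E UNIV X \<subseteq> U"
    unfolding topspace_euclidean by (elim exE conjE)
  let ?C = "\<Inter>i\<in>{i. X i \<noteq> UNIV}. (\<lambda>y. y i) -` X i"
  have "(\<forall>i. y i \<in> X i) \<longleftrightarrow> (\<forall>i. X i \<noteq> UNIV \<longrightarrow> y i \<in> X i)" for y by (metis UNIV_I)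
  then have "Pi\<^sub>E UNIV X = ?C" by (simp add: set_eq_iff PiE_UNIV_domain Pi_iff)
  moreover have "open ?C"
    using X(2) by (intro open_INT ballI open_vimage open_discrete continuous_on_product_coordinates)
  moreover have "closed (X i)" for i by (simp add: closed_def open_discrete)
  then have "closed ?C"
    by (intro closed_INT ballI closed_vimage continuous_on_product_coordinates)
  ultimately show ?thesis using X(1,3) by (intro exI[of _ "Pi\<^sub>E UNIV X"]) simp
qed

text \<open>The function \<open>tan (pi * (t - 1/2))\<close> maps the open unit interval
  homeomorphically onto the line and leaves every compact set at both ends. Sending all other
  parameters to \<open>None\<close> therefore gives a continuous map from the whole line onto the
  circle.\<close>

definition circle_param :: "real \<Rightarrow> real option"
  where "circle_param t = (if 0 < t \<and> t < 1 then Some (tan (pi * (t - 1/2))) else None)"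

lemma circle_param_arctan: "0 < arctan y / pi + 1/2" "arctan y / pi + 1/2 < 1"
  "circle_param (arctan y / pi + 1/2) = Some y"
proof -
  show "0 < arctan y / pi + 1/2" "arctan y / pi + 1/2 < 1"
    using arctan_bounded[of y] by (simp_all add: field_simps)
  then show "circle_param (arctan y / pi + 1/2) = Some y"
    by (simp add: circle_param_def tan_arctan)
qed

lemma circle_param_eq_Some:
  "circle_param t = Some y \<longleftrightarrow> t = arctan y / pi + 1/2"
proof
  assume "circle_param t = Some y"
  then have t: "0 < t" "t < 1" "tan (pi * (t - 1/2)) = y"
    by (auto simp: circle_param_def split: if_splits)
  have "arctan (tan (pi * (t - 1/2))) = pi * (t - 1/2)"
    using t mult_strict_left_mono[of t 1 pi] mult_strict_left_mono[of 0 t pi]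
    by (intro arctan_tan) (simp_all add: algebra_simps)
  with t show "t = arctan y / pi + 1/2" by (simp add: field_simps)
qed (simp add: circle_param_arctan)

lemma continuous_on_circle_param: "continuous_on UNIV circle_param"
proof (rule continuous_on_open_vimage[OF open_UNIV, THEN iffD2], intro allI impI)
  fix U :: "real option set"
  assume "open U"
  then consider (finite) V where "open V" "U = Some ` V"
    | (infinite) C where "compact C" "U = insert None (Some ` (- C))"
    by (auto simp: open_option_iff)
  then show "open (circle_param -` U \<inter> UNIV)"
  proof cases
    case finite
    have "circle_param -` U = (\<lambda>t. tan (pi * (t - 1/2))) -` V \<inter> {0<..<1}"
      unfolding finite(2) by (auto simp: circle_param_def split: if_splits)
    moreover have "cos (pi * (t - 1/2)) \<noteq> 0" if "t \<in> {0<..<1}" for t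
      using that mult_strict_left_mono[of t 1 pi] mult_strict_left_mono[of 0 t pi]
      by (intro less_imp_neq[symmetric] cos_gt_zero_pi) (simp_all add: algebra_simps)
    then have "continuous_on {0<..<1} (\<lambda>t. tan (pi * (t - 1/2)))"
      by (intro continuous_intros) auto
    then have "open ((\<lambda>t. tan (pi * (t - 1/2))) -` V \<inter> {0<..<1})"
      using finite(1) by (simp add: continuous_on_open_vimage)
    ultimately show ?thesis by simp
  next
    case infinite
    \<comment> \<open>No limit of \<open>tan\<close> is computed: the parameters mapped into the
      compact set \<open>C\<close> form the image of \<open>C\<close> under the inverse
      parametrisation, which is compact and hence closed.\<close>
    have "circle_param -` U = - (\<lambda>y. arctan y / pi + 1/2) ` C"
    proof (intro set_eqI)
      fix t
      have "t \<in> circle_param -` U \<longleftrightarrow> (\<forall>y\<in>C. circle_param t \<noteq> Some y)"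
        unfolding infinite(2) by (cases "circle_param t") auto
      then show "t \<in> circle_param -` U \<longleftrightarrow> t \<in> - (\<lambda>y. arctan y / pi + 1/2) ` C"
        by (auto simp: circle_param_eq_Some)
    qed
    moreover have "compact ((\<lambda>y. arctan y / pi + 1/2) ` C)"
      by (intro compact_continuous_image infinite(1) continuous_intros) auto
    ultimately show ?thesis by (simp add: compact_imp_closed open_Compl)
  qed
qed

definition binary_value :: "(nat \<Rightarrow> bool discrete) \<Rightarrow> real"
  where "binary_value x = (\<Sum>n. of_bool (of_discrete (x n)) * (1/2) ^ Suc n)"

lemma continuous_on_discrete_domain: "continuous_on S (f :: 'a discrete \<Rightarrow> _)"
  by (rule continuous_on_subset[OF continuous_on_open_vimage[OF open_UNIV, THEN iffD2]])
    (auto simp: open_discrete)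

text \<open>The partial sums depend on finitely many bits, and a geometric majorant makes them
  converge uniformly.\<close>

lemma continuous_on_binary_value: "continuous_on UNIV binary_value"
proof (rule uniform_limit_theorem)
  let ?f = "\<lambda>n x. of_bool (of_discrete (x n)) * (1/2) ^ Suc n :: real"
  show "uniform_limit UNIV (\<lambda>n x. \<Sum>i<n. ?f i x) binary_value sequentially"
    unfolding binary_value_def
  proof (rule Weierstrass_m_test)
    show "summable (\<lambda>n. (1/2 :: real) ^ Suc n)" 
      unfolding power_Suc by (intro summable_mult summable_geometric) simp
  qed (simp add: of_bool_def)
  show "\<forall>\<^sub>F n in sequentially. continuous_on UNIV (\<lambda>x. \<Sum>i<n. ?f i x)"
    by (intro always_eventually allI continuous_intros
        continuous_on_compose2[OF continuous_on_discrete_domain[of UNIV "\<lambda>b. of_bool (of_discrete b)"]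
        continuous_on_product_coordinates]) auto
qed simp

text \<open>The digits are the parities of \<open>\<lfloor>2 ^ Suc n * t\<rfloor>\<close>. The
  partial sums become the truncations \<open>\<lfloor>2 ^ n * t\<rfloor> / 2 ^ n\<close>, which lie
  within \<open>(1/2) ^ n\<close> of \<open>t\<close>; the base case is that \<open>t\<close> has
  integer part 0.\<close>

lemma binary_value_surj:
  assumes t: "0 \<le> t" "t < 1"
  shows "\<exists>x. binary_value x = t"
proof -
  define x where "x n = discrete (odd \<lfloor>2 ^ Suc n * t\<rfloor>)" for n
  have floor_double: "\<lfloor>2 * u\<rfloor> = 2 * \<lfloor>u\<rfloor> + of_bool (odd \<lfloor>2 * u\<rfloor>)" for u :: real
  proof -
    have "\<lfloor>2 * u\<rfloor> = 2 * \<lfloor>u\<rfloor> \<or> \<lfloor>2 * u\<rfloor> = 2 * \<lfloor>u\<rfloor> + 1" by linarith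
    then show ?thesis by auto
  qed
  have partial: "(\<Sum>i<n. of_bool (of_discrete (x i)) * (1/2) ^ Suc i) = \<lfloor>2 ^ n * t\<rfloor> / 2 ^ n" for n
  proof (induction n)
    case 0
    have "\<lfloor>t\<rfloor> = 0" using t by linarith
    then show ?case by simp
  next
    case (Suc n)
    have "real_of_int \<lfloor>2 ^ Suc n * t\<rfloor> =
        2 * real_of_int \<lfloor>2 ^ n * t\<rfloor> + of_bool (of_discrete (x n))"
      using arg_cong[OF floor_double[of "2 ^ n * t"], of real_of_int]
      by (simp add: x_def discrete_inverse mult.assoc)
    with Suc show ?case by (simp add: field_simps)
  qed
  have "(\<lambda>n. \<lfloor>2 ^ n * t\<rfloor> / 2 ^ n) \<longlonglongrightarrow> t"
  proof (rule Lim_null[THEN iffD2], rule Lim_null_comparison)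
    have "\<bar>\<lfloor>2 ^ n * t\<rfloor> / 2 ^ n - t\<bar> \<le> (1/2) ^ n" for n :: nat
    proof -
      have "\<bar>\<lfloor>2 ^ n * t\<rfloor> - 2 ^ n * t\<bar> \<le> 1" by linarith
      then have "\<bar>\<lfloor>2 ^ n * t\<rfloor> - 2 ^ n * t\<bar> / 2 ^ n \<le> 1 / 2 ^ n" by (rule divide_right_mono) simp
      also have "\<bar>\<lfloor>2 ^ n * t\<rfloor> - 2 ^ n * t\<bar> / 2 ^ n = \<bar>\<lfloor>2 ^ n * t\<rfloor> / 2 ^ n - t\<bar>"
      proof -
        have "\<lfloor>2 ^ n * t\<rfloor> / 2 ^ n - t = (\<lfloor>2 ^ n * t\<rfloor> - 2 ^ n * t) / 2 ^ n"
          by (simp add: diff_divide_distrib)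
        then show ?thesis by simp
      qed
      finally show ?thesis by (simp add: power_one_over)
    qed
    then show "\<forall>\<^sub>F n in sequentially. norm (\<lfloor>2 ^ n * t\<rfloor> / 2 ^ n - t) \<le> (1/2) ^ n"
      by (intro always_eventually) simp
  qed (simp add: LIMSEQ_power_zero)
  then have "binary_value x = t"
    unfolding binary_value_def by (intro sums_unique[symmetric]) (simp add: sums_def partial del: power_Suc)
  then show ?thesis by blast
qed

text \<open>\<open>prod_encode\<close> splits one bit sequence into countably many independent ones,
  and each of them determines one coordinate through a binary expansion and the parametrisation of
  the circle.\<close>

lemma cantor_onto_Omega:
  "\<exists>q :: (nat \<Rightarrow> bool discrete) \<Rightarrow> (nat \<Rightarrow> real option). continuous_on UNIV q \<and> surj q"
proof -
  define q :: "(nat \<Rightarrow> bool discrete) \<Rightarrow> (nat \<Rightarrow> real option)"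
    where "q x i = circle_param (binary_value (\<lambda>j. x (prod_encode (i, j))))" for x i
  have "continuous_on UNIV (\<lambda>x :: nat \<Rightarrow> bool discrete. \<lambda>j. x (prod_encode (i, j)))" for i
    by (intro continuous_on_coordinatewise_then_product continuous_on_product_coordinates)
  then have "continuous_on UNIV q"
    unfolding q_def
    by (intro continuous_on_coordinatewise_then_product
        continuous_on_compose2[OF continuous_on_circle_param]
        continuous_on_compose2[OF continuous_on_binary_value]) auto
  moreover have "\<exists>x. q x = \<omega>" for \<omega>
  proof -
    have "\<exists>x. circle_param (binary_value x) = \<omega> i" for i
    proof (cases "\<omega> i")
      case None
      obtain x where "binary_value x = 0" using binary_value_surj[of 0] by auto
      with None show ?thesis by (intro exI[of _ x]) (simp add: circle_param_def)
    next
      case (Some y)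
      obtain x where "binary_value x = arctan y / pi + 1/2"
        using binary_value_surj[of "arctan y / pi + 1/2"] circle_param_arctan[of y] by auto
      with Some show ?thesis by (intro exI[of _ x]) (simp add: circle_param_arctan)
    qed
    then obtain z where z: "\<And>i. circle_param (binary_value (z i)) = \<omega> i" by metis
    have "q (\<lambda>n. case prod_decode n of (i, j) \<Rightarrow> z i j) = \<omega>"
      by (auto simp: q_def z)
    then show ?thesis by blast
  qed
  ultimately show ?thesis by (metis surj_def)
qed

section \<open>Measures annihilating a subspace that is not dense\<close>

lemma sublinear_SUP_bcontfun: "sublinear (\<lambda>f :: 'a::topological_space \<Rightarrow>\<^sub>C real. SUP x. apply_bcontfun f x)"
proof (rule sublinearI)
  have bdd: "bdd_above (range (apply_bcontfun f))" for f :: "'a \<Rightarrow>\<^sub>C real"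
    by (intro bounded_imp_bdd_above bounded_apply_bcontfun)
  have upper: "apply_bcontfun f x \<le> (SUP x. apply_bcontfun f x)" for f :: "'a \<Rightarrow>\<^sub>C real" and x
    by (rule cSUP_upper[OF UNIV_I bdd])
  show "(SUP x. apply_bcontfun (f + g) x) \<le> (SUP x. apply_bcontfun f x) + (SUP x. apply_bcontfun g x)"
    for f g :: "'a \<Rightarrow>\<^sub>C real"
    by (rule cSUP_least) (simp_all add: add_mono upper)
  show "(SUP x. apply_bcontfun (c *\<^sub>R f) x) \<le> c * (SUP x. apply_bcontfun f x)" if "0 < c"
    for c and f :: "'a \<Rightarrow>\<^sub>C real"
    by (rule cSUP_least) (use that in \<open>simp_all add: upper\<close>)
  show "(SUP x. apply_bcontfun (0 :: 'a \<Rightarrow>\<^sub>C real) x) = 0" by simp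
qed

text \<open>Drops the coordinate that is reserved for the sign.\<close>

definition stream_tail :: "(nat \<Rightarrow> 'a) \<Rightarrow> nat \<Rightarrow> 'a"
  where "stream_tail x n = x (Suc n)"

text \<open>
  The first bit of the Cantor space carries a sign, so that a functional dominated by the supremum
  on the Cantor space is automatically positive, while its pullback along the embedding
  \<open>f \<mapsto> \<plusminus> f \<circ> q\<close> ranges over all functionals on continuous functions dominated by the norm. This
  replaces the Jordan decomposition.
\<close>

definition signed_pullback ::
    "((nat \<Rightarrow> bool discrete) \<Rightarrow> 'a::topological_space) \<Rightarrow> ('a \<Rightarrow>\<^sub>C real) \<Rightarrow> (nat \<Rightarrow> bool discrete) \<Rightarrow>\<^sub>C real"
  where "signed_pullback q f = Bcontfun (\<lambda>x.
    (if of_discrete (x 0) then 1 else - 1) * apply_bcontfun f (q (stream_tail x)))"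

lemma continuous_on_stream_tail:
  "continuous_on UNIV (stream_tail :: (nat \<Rightarrow> 'a::topological_space) \<Rightarrow> _)"
  unfolding stream_tail_def
  by (intro continuous_on_coordinatewise_then_product continuous_on_product_coordinates)

lemma continuous_on_first_bit:
  "continuous_on UNIV (\<lambda>x :: nat \<Rightarrow> bool discrete. f (x 0))"
  by (rule continuous_on_compose2[OF continuous_on_discrete_domain[of UNIV f]
      continuous_on_product_coordinates]) simp

lemma apply_signed_pullback:
  assumes "continuous_on UNIV q"
  shows "apply_bcontfun (signed_pullback q f) x =
    (if of_discrete (x 0) then 1 else - 1) * apply_bcontfun f (q (stream_tail x))"
proof -
  have "continuous_on UNIV (\<lambda>x. (if of_discrete (x 0) then 1 else - 1) * apply_bcontfun f (q (stream_tail x)))"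
    by (intro continuous_on_mult continuous_on_first_bit[of "\<lambda>b. if of_discrete b then 1 else - 1"]
        continuous_on_compose2[OF continuous_on_apply_bcontfun[of UNIV]]
        continuous_on_compose2[OF assms continuous_on_stream_tail]) auto
  then show ?thesis
    unfolding signed_pullback_def by (simp only: compact_apply_Bcontfun[OF compact_cantor])
qed

lemma linear_signed_pullback:
  assumes "continuous_on UNIV q"
  shows "linear (signed_pullback q)"
  by (rule linearI; rule bcontfun_eqI; simp add: apply_signed_pullback[OF assms])

text \<open>Both signs occur over every point, so the supremum sees \<open>f\<close> as well as
  \<open>- f\<close>; surjectivity of \<open>q\<close> turns it into the full norm.\<close>

lemma signed_pullback_SUP:
  assumes q: "continuous_on UNIV q" "surj q"
  shows "(SUP x. apply_bcontfun (signed_pullback q f) x) = norm f"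
proof (rule antisym)
  have bdd: "bdd_above (range (apply_bcontfun (signed_pullback q f)))"
    by (intro bounded_imp_bdd_above bounded_apply_bcontfun)
  show "(SUP x. apply_bcontfun (signed_pullback q f) x) \<le> norm f"
  proof (rule cSUP_least)
    show "apply_bcontfun (signed_pullback q f) x \<le> norm f" for x
      using norm_bounded[of f "q (stream_tail x)"]
      by (auto simp: apply_signed_pullback[OF q(1)] abs_le_iff)
  qed simp
  show "norm f \<le> (SUP x. apply_bcontfun (signed_pullback q f) x)"
  proof (rule norm_bound)
    fix a
    obtain y where y: "a = q y" using q(2) by (rule surjE)
    \<comment> \<open>\<open>case_nat (discrete b) y\<close> is the sequence \<open>y\<close> with
      the sign bit \<open>b\<close> put in front.\<close>
    have at_point: "apply_bcontfun (signed_pullback q f) (case_nat (discrete b) y) = (if b then 1 else - 1) * apply_bcontfun f a" for b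
    proof -
      have "stream_tail (case_nat (discrete b) y) = y" by (simp add: stream_tail_def fun_eq_iff)
      then show ?thesis by (simp add: apply_signed_pullback[OF q(1)] discrete_inverse y)
    qed
    have "(if b then 1 else - 1) * apply_bcontfun f a \<le> (SUP x. apply_bcontfun (signed_pullback q f) x)" for b
      unfolding at_point[symmetric] by (rule cSUP_upper[OF UNIV_I bdd])
    from this[of True] this[of False]
    show "norm (apply_bcontfun f a) \<le> (SUP x. apply_bcontfun (signed_pullback q f) x)"
      by (simp add: abs_le_iff)
  qed
qed

text \<open>Hahn-Banach on the Cantor space gives a functional that vanishes on the pullback of
  \<open>S\<close> but not at that of \<open>f\<close>. It is integration against a measure
  \<open>R\<close>; splitting \<open>R\<close> by the sign bit and pushing both halves forward
  produces the two measures.\<close>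

theorem subspace_not_dense_annihilating_measures:
  fixes q :: "(nat \<Rightarrow> bool discrete) \<Rightarrow> 'a::topological_space"
    and S :: "('a \<Rightarrow>\<^sub>C real) set"
  assumes q: "continuous_on UNIV q" "surj q"
    and S: "subspace S" and f: "f \<notin> closure S"
  shows "\<exists>M N. finite_measure M \<and> sets M = sets borel \<and> finite_measure N \<and> sets N = sets borel \<and>
    (\<forall>s\<in>S. (\<integral>x. apply_bcontfun s x \<partial>M) = (\<integral>x. apply_bcontfun s x \<partial>N)) \<and>
    (\<integral>x. apply_bcontfun f x \<partial>M) \<noteq> (\<integral>x. apply_bcontfun f x \<partial>N)"
proof -
  let ?T = "signed_pullback q"
  let ?p = "\<lambda>g :: (nat \<Rightarrow> bool discrete) \<Rightarrow>\<^sub>C real. SUP x. apply_bcontfun g x"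
  note T = linear_signed_pullback[OF q(1)]
  obtain d where d: "0 < d" "\<And>s. s \<in> S \<Longrightarrow> d \<le> norm (f - s)"
    using f unfolding closure_approachable by (auto simp: not_less dist_norm norm_minus_commute)
  have "\<exists>L. linear L \<and> (\<forall>g. L g \<le> ?p g) \<and> (\<forall>u\<in>?T ` S. L u = 0) \<and> d \<le> L (?T f)"
  proof (rule hahn_banach_annihilator[OF sublinear_SUP_bcontfun])
    show "subspace (?T ` S)" by (rule linear_subspace_image[OF T S])
    show "0 \<le> ?p u" if "u \<in> ?T ` S" for u
      using that by (auto simp: signed_pullback_SUP[OF q])
    show "d \<le> ?p (?T f - u)" if u: "u \<in> ?T ` S" for u
    proof -
      obtain s where s: "u = ?T s" "s \<in> S" using u by (rule imageE)
      have "?T f - u = ?T (f - s)" by (simp add: s(1) linear_diff[OF T])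
      then show ?thesis using d(2)[OF s(2)] by (simp add: signed_pullback_SUP[OF q])
    qed
  qed
  then obtain L where L: "linear L" "\<forall>g. L g \<le> ?p g" "\<forall>u\<in>?T ` S. L u = 0" "d \<le> L (?T f)"
    by (elim exE conjE)
  \<comment> \<open>Positivity results from testing domination by the supremum on
    \<open>- g\<close>.\<close>
  have "0 \<le> L g" if "\<And>x. 0 \<le> apply_bcontfun g x" for g
  proof -
    have "L (- g) \<le> ?p (- g)" using L(2) by (rule spec)
    also have "\<dots> \<le> 0" by (rule cSUP_least) (use that in simp_all)
    finally show ?thesis by (simp add: linear_neg[OF L(1)])
  qed
  note pos = this
  have "\<exists>R. finite_measure R \<and> sets R = sets borel \<and> (\<forall>g. L g = (\<integral>x. apply_bcontfun g x \<partial>R))"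
    by (rule riesz_zero_dimensional[OF compact_cantor cantor_clopen_base L(1) pos]) simp_all
  then obtain R where R: "finite_measure R" "sets R = sets borel"
    and LR: "\<forall>g. L g = (\<integral>x. apply_bcontfun g x \<partial>R)" by (elim exE conjE)
  interpret finite_measure R by (rule R(1))
  have space: "space R = UNIV" using sets_eq_imp_space_eq[OF R(2)] by simp
  \<comment> \<open>\<open>A True\<close> and \<open>A False\<close> are the halves of positive and
    negative sign, and \<open>N b\<close> is the image of \<open>R\<close> restricted to
    \<open>A b\<close>.\<close>
  define A where "A b = {x :: nat \<Rightarrow> bool discrete. of_discrete (x 0) = b}" for b
  define N where "N b = distr (density R (indicator (A b))) borel (\<lambda>x. q (stream_tail x))" for b
  have "open (A b)" for b
  proof -
    have "open ((\<lambda>x :: nat \<Rightarrow> bool discrete. x 0) -` {c. of_discrete c = b})"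
      by (intro open_vimage open_discrete continuous_on_product_coordinates)
    then show ?thesis by (simp add: A_def vimage_def)
  qed
  then have A: "A b \<in> sets R" for b unfolding R(2) by (rule borel_open)
  have meas: "(\<lambda>x. q (stream_tail x)) \<in> measurable R borel"
    unfolding measurable_cong_sets[OF R(2) refl]
    by (intro borel_measurable_continuous_onI continuous_on_compose2[OF q(1) continuous_on_stream_tail]) simp
  have finite_N: "finite_measure (N b)" for b
  proof -
    have "finite_measure (density R (indicator (A b)))"
      using emeasure_restricted[OF A[of b] sets.top] by (intro finite_measureI) simp
    then show ?thesis
      unfolding N_def by (rule finite_measure.finite_measure_distr) (use meas in simp)
  qed
  have measurable: "apply_bcontfun g \<in> borel_measurable borel" for g :: "'a \<Rightarrow>\<^sub>C real"
    by (intro borel_measurable_continuous_onI continuous_on_apply_bcontfun)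
  have N: "(\<integral>x. apply_bcontfun g x \<partial>N b) = (\<integral>x. indicator (A b) x * apply_bcontfun g (q (stream_tail x)) \<partial>R)"
    for b and g :: "'a \<Rightarrow>\<^sub>C real"
  proof -
    have "(\<integral>x. apply_bcontfun g x \<partial>N b) = (\<integral>x. apply_bcontfun g (q (stream_tail x)) \<partial>density R (indicator (A b)))"
      unfolding N_def by (rule integral_distr) (use meas measurable in simp_all)
    also have "density R (indicator (A b)) = density R (\<lambda>x. ennreal (indicator (A b) x))"
      by (simp add: ennreal_indicator)
    also have "(\<integral>x. apply_bcontfun g (q (stream_tail x)) \<partial>\<dots>) =
        (\<integral>x. indicator (A b) x *\<^sub>R apply_bcontfun g (q (stream_tail x)) \<partial>R)"
      by (rule integral_density) (use A measurable_compose[OF meas measurable] in simp_all)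
    finally show ?thesis by simp
  qed
  \<comment> \<open>On the two halves the pullback of \<open>g\<close> is the composition of
    \<open>g\<close> with the projection, up to opposite signs, so the functional is a difference of
    integrals.\<close>
  have L_N: "L (?T g) = (\<integral>x. apply_bcontfun g x \<partial>N True) - (\<integral>x. apply_bcontfun g x \<partial>N False)" for g
  proof -
    have "integrable R (\<lambda>x. apply_bcontfun g (q (stream_tail x)))"
      using norm_bounded[of g] measurable_compose[OF meas measurable[of g]]
      by (intro integrable_const_bound[where B = "norm g"] AE_I2) simp_all
    then have int: "integrable R (\<lambda>x. indicator (A b) x * apply_bcontfun g (q (stream_tail x)))" for b
      unfolding real_scaleR_def[symmetric] by (rule integrable_mult_indicator[OF A])
    have "L (?T g) = (\<integral>x. apply_bcontfun (?T g) x \<partial>R)" using LR by (rule spec)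
    also have "\<dots> = (\<integral>x. indicator (A True) x * apply_bcontfun g (q (stream_tail x)) -
        indicator (A False) x * apply_bcontfun g (q (stream_tail x)) \<partial>R)"
      by (intro Bochner_Integration.integral_cong refl)
        (simp add: apply_signed_pullback[OF q(1)] A_def indicator_def)
    also have "\<dots> = (\<integral>x. apply_bcontfun g x \<partial>N True) - (\<integral>x. apply_bcontfun g x \<partial>N False)"
      unfolding N by (rule Bochner_Integration.integral_diff[OF int int])
    finally show ?thesis .
  qed
  have "(\<integral>x. apply_bcontfun s x \<partial>N True) = (\<integral>x. apply_bcontfun s x \<partial>N False)" if "s \<in> S" for s
    using L(3) that L_N[of s] by simp
  moreover have "(\<integral>x. apply_bcontfun f x \<partial>N True) \<noteq> (\<integral>x. apply_bcontfun f x \<partial>N False)"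
    using L(4) d(1) L_N[of f] by simp
  moreover have "sets (N b) = sets borel" for b by (simp add: N_def)
  ultimately show ?thesis
    using finite_N by (intro exI[of _ "N True"] exI[of _ "N False"] conjI ballI)
qed

section \<open>Translates of a sigmoidal function determine measures on the line\<close>

lemma antiderivative_exists_real:
  fixes f :: "real \<Rightarrow> real"
  assumes "continuous_on UNIV f"
  shows "\<exists>F. \<forall>x. (F has_real_derivative f x) (at x)"
proof (intro exI allI)
  fix x :: real
  \<comment> \<open>The interval contains the base point 0 and has \<open>x\<close> in its interior,
    so the derivative within it is a full derivative.\<close>
  have "((\<lambda>u. LBINT y=ereal 0..u. f y) has_vector_derivative f x)
      (at x within {min 0 (x - 1)..max 0 (x + 1)})"
    by (intro interval_integral_FTC2 continuous_on_subset[OF assms]) auto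
  then show "((\<lambda>u. LBINT y=ereal 0..u. f y) has_real_derivative f x) (at x)"
    by (simp add: has_real_derivative_iff_has_vector_derivative at_within_Icc_at)
qed

lemma iterated_antiderivatives_exist:
  fixes f :: "real \<Rightarrow> real"
  assumes "continuous_on UNIV f"
  shows "\<exists>F :: nat \<Rightarrow> real \<Rightarrow> real. F 0 = f \<and> (\<forall>n x. (F (Suc n) has_real_derivative F n x) (at x))"
proof -
  \<comment> \<open>Choice turns antidifferentiation into an operator that can be iterated. It is
    controlled only on continuous functions, so continuity is carried along.\<close>
  define J where "J g = (SOME G. \<forall>x. (G has_real_derivative g x) (at x))" for g :: "real \<Rightarrow> real"
  have J: "(J g has_real_derivative g x) (at x)" if "continuous_on UNIV g" for g x
    using someI_ex[OF antiderivative_exists_real[OF that]] unfolding J_def by blast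
  have "continuous_on UNIV ((J ^^ n) f)" for n
  proof (induction n)
    case (Suc n)
    show ?case
      by (intro continuous_at_imp_continuous_on) (auto intro: DERIV_isCont J[OF Suc])
  qed (simp add: assms)
  then show ?thesis by (intro exI[of _ "\<lambda>n. (J ^^ n) f"]) (simp add: J)
qed

text \<open>For positive \<open>m\<close>, Maclaurin's formula has no remainder because
  \<open>h 0\<close> vanishes, so \<open>h m\<close> is a polynomial. If it were not constant, it
  would be unbounded along \<open>a\<close>, against the limit \<open>l\<close>.\<close>

lemma bounded_iterated_derivative_zero_const:
  fixes h :: "nat \<Rightarrow> real \<Rightarrow> real"
  assumes h0: "\<And>x. h 0 x = 0" and h: "\<And>n x. (h (Suc n) has_real_derivative h n x) (at x)"
    and lim: "((\<lambda>n. h m (a n)) \<longlonglongrightarrow> l)" "((\<lambda>n. h m (b n)) \<longlonglongrightarrow> k)"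
    and a: "filterlim a at_infinity sequentially" and b: "filterlim b at_infinity sequentially"
  shows "l = k"
proof (cases m)
  case 0
  with h0 lim show ?thesis by (auto dest: LIMSEQ_unique simp: tendsto_const_iff)
next
  case (Suc n)
  \<comment> \<open>The derivative of order \<open>k\<close> of \<open>h m\<close> is
    \<open>h (m - k)\<close>, so these are the Maclaurin coefficients of \<open>h m\<close>.\<close>
  define c where "c k = h (m - k) 0 / fact k" for k
  have poly: "h m x = (\<Sum>i\<le>n. c i * x ^ i)" for x
  proof -
    have "\<exists>t. \<bar>t\<bar> \<le> \<bar>x\<bar> \<and> h m x = (\<Sum>i<m. h (m - i) 0 / fact i * x ^ i) + h (m - m) t / fact m * x ^ m"
    proof (rule Maclaurin_bi_le)
      show "\<forall>i t. i < m \<and> \<bar>t\<bar> \<le> \<bar>x\<bar> \<longrightarrow> (h (m - i) has_real_derivative h (m - Suc i) t) (at t)"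
        using h by (metis Suc_diff_Suc)
    qed simp
    then show ?thesis using h0 Suc by (auto simp: c_def lessThan_Suc_atMost)
  qed
  show ?thesis
  proof (cases "\<exists>k. k \<noteq> 0 \<and> k \<le> n \<and> c k \<noteq> 0")
    case True
    have "\<forall>\<^sub>F z in at_infinity. \<bar>l\<bar> + 1 \<le> norm (h m z)"
      unfolding poly by (rule polyfun_extremal[OF True])
    then have "\<forall>\<^sub>F i in sequentially. \<bar>l\<bar> + 1 \<le> norm (h m (a i))"
      using a unfolding filterlim_iff by blast
    moreover have "(\<lambda>i. norm (h m (a i))) \<longlonglongrightarrow> \<bar>l\<bar>" using tendsto_norm[OF lim(1)] by simp
    ultimately have "\<bar>l\<bar> + 1 \<le> \<bar>l\<bar>" by (intro tendsto_lowerbound) auto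
    then show ?thesis by simp
  next
    case False
    then have "c (Suc i) = 0" if "i < n" for i
      using that by (metis Suc_leI nat.distinct(1))
    then have "h m x = c 0" for x
      unfolding poly by (subst sum.atMost_shift) simp
    with lim show ?thesis by (auto dest: LIMSEQ_unique simp: tendsto_const_iff)
  qed
qed

section \<open>Bounded functions and compactly supported measures on the line\<close>

lemma continuous_abs_bounded_Icc:
  fixes f :: "real \<Rightarrow> real"
  assumes "continuous_on UNIV f"
  shows "\<exists>B. \<forall>x\<in>{a..b}. \<bar>f x\<bar> \<le> B"
proof -
  have "bounded (f ` {a..b})"
    by (intro compact_imp_bounded compact_continuous_image continuous_on_subset[OF assms]) auto
  then show ?thesis by (auto simp: bounded_iff)
qed

lemma bounded_of_limits_real:
  fixes f :: "real \<Rightarrow> real"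
  assumes "continuous_on UNIV f" "(f \<longlongrightarrow> a) at_bot" "(f \<longlongrightarrow> b) at_top"
  shows "\<exists>B. \<forall>x. \<bar>f x\<bar> \<le> B"
proof -
  obtain s where s: "\<And>x. x \<le> s \<Longrightarrow> \<bar>f x - a\<bar> < 1"
    using tendstoD[OF assms(2), of 1] by (auto simp: eventually_at_bot_linorder dist_real_def)
  obtain t where t: "\<And>x. t \<le> x \<Longrightarrow> \<bar>f x - b\<bar> < 1"
    using tendstoD[OF assms(3), of 1] by (auto simp: eventually_at_top_linorder dist_real_def)
  obtain B where "\<forall>x\<in>{s..t}. \<bar>f x\<bar> \<le> B"
    using continuous_abs_bounded_Icc[OF assms(1)] by blast
  then have B: "s \<le> x \<Longrightarrow> x \<le> t \<Longrightarrow> \<bar>f x\<bar> \<le> B" for x by simp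
  have "\<bar>f x\<bar> \<le> max B (max (\<bar>a\<bar> + 1) (\<bar>b\<bar> + 1))" for x
    using s[of x] t[of x] B[of x] by linarith
  then show ?thesis by blast
qed

text \<open>Continuous functions on a compact space are bounded, so the images of finite Borel
  measures under them are of this kind.\<close>

locale compactly_supported_measure = finite_measure M for M :: "real measure" +
  fixes R :: real
  assumes sets_borel [measurable_cong]: "sets M = sets borel"
    and support: "AE x in M. \<bar>x\<bar> \<le> R"
begin

lemma integrable_continuous:
  assumes "continuous_on UNIV f"
  shows "integrable M (f :: real \<Rightarrow> real)"
proof -
  obtain B where "\<forall>x\<in>{-R..R}. \<bar>f x\<bar> \<le> B"
    using continuous_abs_bounded_Icc[OF assms] by blast
  then have B: "\<bar>f x\<bar> \<le> B" if "\<bar>x\<bar> \<le> R" for x using that by (simp add: abs_le_iff)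
  have "f \<in> borel_measurable M"
    using borel_measurable_continuous_onI[OF assms] measurable_cong_sets[OF sets_borel refl] by blast
  then show ?thesis
    using support by (intro integrable_const_bound[where B = B]) (auto elim!: eventually_mono intro: B)
qed

lemma tendsto_integral:
  fixes f :: "nat \<Rightarrow> real \<Rightarrow> real"
  assumes f: "\<And>n. f n \<in> borel_measurable borel" and g: "g \<in> borel_measurable borel"
    and lim: "\<And>x. \<bar>x\<bar> \<le> R \<Longrightarrow> (\<lambda>n. f n x) \<longlonglongrightarrow> g x"
    and bound: "\<And>n x. \<bar>x\<bar> \<le> R \<Longrightarrow> \<bar>f n x\<bar> \<le> B"
  shows "(\<lambda>n. \<integral>x. f n x \<partial>M) \<longlonglongrightarrow> (\<integral>x. g x \<partial>M)"
proof (rule integral_dominated_convergence[where w = "\<lambda>_. B"])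
  show "f n \<in> borel_measurable M" "g \<in> borel_measurable M" for n
    using f g measurable_cong_sets[OF sets_borel refl] by blast+
  show "AE x in M. norm (f n x) \<le> B" for n
    using support by eventually_elim (use bound in auto)
  show "AE x in M. (\<lambda>n. f n x) \<longlonglongrightarrow> g x"
    using support by eventually_elim (rule lim)
qed simp

text \<open>Differentiation under the integral: for increments of size at most 1 the mean value
  inequality bounds the difference quotients by the maximum of \<open>g\<close> on a compact
  interval, and dominated convergence applies.\<close>

lemma has_derivative_integral_translate:
  assumes G: "\<And>x. (G has_real_derivative g x) (at x)" and g: "continuous_on UNIV g"
  shows "((\<lambda>c. \<integral>x. G (c + x) \<partial>M) has_real_derivative (\<integral>x. g (c + x) \<partial>M)) (at c)"
proof -
  have contG: "continuous_on UNIV G"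
    by (intro continuous_at_imp_continuous_on) (auto intro: DERIV_isCont G)
  have intG: "integrable M (\<lambda>x. G (t + x))" for t
    by (intro integrable_continuous continuous_intros continuous_on_compose2[OF contG]) auto
  obtain B where "\<forall>x\<in>{c - R - 1..c + R + 1}. \<bar>g x\<bar> \<le> B"
    using continuous_abs_bounded_Icc[OF g] by blast
  then have B: "\<bar>g x\<bar> \<le> B" if "\<bar>x - c\<bar> \<le> R + 1" for x
    using that by (simp add: abs_le_iff algebra_simps)
  have "(\<lambda>n. ((\<integral>x. G (s n + x) \<partial>M) - (\<integral>x. G (c + x) \<partial>M)) / (s n - c)) \<longlonglongrightarrow> (\<integral>x. g (c + x) \<partial>M)"
    if s: "\<And>n. s n \<noteq> c" "\<And>n. \<bar>s n - c\<bar> \<le> 1" "s \<longlonglongrightarrow> c" for s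
  proof -
    have eq: "((\<integral>x. G (s n + x) \<partial>M) - (\<integral>x. G (c + x) \<partial>M)) / (s n - c)
        = (\<integral>x. (G (s n + x) - G (c + x)) / (s n - c) \<partial>M)" for n
      using intG by (simp add: Bochner_Integration.integral_diff)
    show ?thesis
      unfolding eq
    proof (rule tendsto_integral[where B = B])
      fix x
      have "filterlim (\<lambda>n. s n + x) (at (c + x)) sequentially"
        using s by (intro filterlim_atI tendsto_intros) auto
      moreover have "((\<lambda>y. (G y - G (c + x)) / (y - (c + x))) \<longlongrightarrow> g (c + x)) (at (c + x))"
        using G[of "c + x"] by (simp add: has_field_derivative_iff)
      ultimately show "(\<lambda>n. (G (s n + x) - G (c + x)) / (s n - c)) \<longlonglongrightarrow> g (c + x)"
        by (force dest: filterlim_compose)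
    next
      fix n and x :: real assume x: "\<bar>x\<bar> \<le> R"
      have "\<bar>G (s n + x) - G (c + x)\<bar> \<le> B * \<bar>s n + x - (c + x)\<bar>"
        using field_differentiable_bound[of "cball c (R + 1)" G g B "c + x" "s n + x"] x s(2)[of n] G B
        by (auto simp: dist_real_def abs_minus_commute has_field_derivative_at_within)
      then show "\<bar>(G (s n + x) - G (c + x)) / (s n - c)\<bar> \<le> B"
        using s(1)[of n] by (simp add: abs_divide divide_le_eq)
    qed (intro borel_measurable_continuous_onI continuous_intros continuous_on_compose2[OF g]
          continuous_on_compose2[OF contG]; use s in auto)+
  qed
  note * = this
  show ?thesis
    unfolding has_field_derivative_iff tendsto_at_iff_sequentially
  proof (intro allI impI, simp add: comp_def)
    fix s :: "nat \<Rightarrow> real"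
    assume s: "\<forall>i. s i \<noteq> c" "s \<longlonglongrightarrow> c"
    then obtain N where N: "\<And>n. N \<le> n \<Longrightarrow> \<bar>s n - c\<bar> < 1"
      using LIMSEQ_D[of s c 1] by auto
    \<comment> \<open>Passing to a tail keeps the sequence within distance 1 of \<open>c\<close>,
      where the bound \<open>B\<close> is valid.\<close>
    have "(\<lambda>n. ((\<integral>x. G (s (n + N) + x) \<partial>M) - (\<integral>x. G (c + x) \<partial>M)) / (s (n + N) - c))
        \<longlonglongrightarrow> (\<integral>x. g (c + x) \<partial>M)"
      by (rule *) (use s N LIMSEQ_ignore_initial_segment in \<open>auto intro: less_imp_le\<close>)
    then show "(\<lambda>n. ((\<integral>x. G (s n + x) \<partial>M) - (\<integral>x. G (c + x) \<partial>M)) / (s n - c))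
        \<longlonglongrightarrow> (\<integral>x. g (c + x) \<partial>M)"
      by (rule LIMSEQ_offset)
  qed
qed

end

text \<open>Strong induction: equality of the lower moments cancels the Taylor polynomial of an
  \<open>m\<close>-fold antiderivative of \<phi>, and the remainder isolates the moment of order
  \<open>m\<close>.\<close>

lemma moments_eq_of_translates:
  fixes \<phi> :: "real \<Rightarrow> real"
  assumes M: "compactly_supported_measure M R" and N: "compactly_supported_measure N R"
    and \<phi>: "continuous_on UNIV \<phi>" "(\<phi> \<longlongrightarrow> 0) at_bot" "(\<phi> \<longlongrightarrow> 1) at_top"
    and eq: "\<And>c. (\<integral>x. \<phi> (c + x) \<partial>M) = (\<integral>x. \<phi> (c + x) \<partial>N)"
  shows "(\<integral>x. x ^ m \<partial>M) = (\<integral>x. x ^ m \<partial>N)"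
proof (induction m rule: less_induct)
  case (less m)
  interpret M: compactly_supported_measure M R by (rule M)
  interpret N: compactly_supported_measure N R by (rule N)
  obtain F :: "nat \<Rightarrow> real \<Rightarrow> real" where F0: "F 0 = \<phi>"
    and F: "\<And>n x. (F (Suc n) has_real_derivative F n x) (at x)"
    using iterated_antiderivatives_exist[OF \<phi>(1)] by blast
  obtain B where B: "\<And>x. \<bar>\<phi> x\<bar> \<le> B" using bounded_of_limits_real[OF \<phi>] by blast
  have contF: "continuous_on UNIV (F n)" for n
    using \<phi>(1) F0 F by (cases n) (auto intro!: continuous_at_imp_continuous_on intro: DERIV_isCont)
  have contF': "continuous_on UNIV (\<lambda>x. F n (c + x))" for n c
    by (intro continuous_on_compose2[OF contF] continuous_intros) auto
  define h where "h n c = (\<integral>x. F n (c + x) \<partial>M) - (\<integral>x. F n (c + x) \<partial>N)" for n c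
  have h0: "h 0 c = 0" for c by (simp add: h_def F0 eq)
  have h_deriv: "(h (Suc n) has_real_derivative h n c) (at c)" for n c
    unfolding h_def
    by (intro DERIV_diff M.has_derivative_integral_translate N.has_derivative_integral_translate
        F contF)
  \<comment> \<open>\<open>T c\<close> is the Taylor polynomial of degree less than \<open>m\<close>
    of \<open>F m\<close> at \<open>c\<close>, in the increment \<open>x\<close>; the derivative of
    order \<open>k\<close> of \<open>F m\<close> is \<open>F (m - k)\<close>.\<close>
  define T where "T c x = (\<Sum>k<m. F (m - k) c / fact k * x ^ k)" for c x
  define r where "r c x = F m (c + x) - T c x" for c x
  have contT: "continuous_on UNIV (T c)" for c
    unfolding T_def by (intro continuous_intros)
  have contr: "continuous_on UNIV (r c)" for c
    unfolding r_def by (intro continuous_intros contF' contT)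
  have "(\<integral>x. T c x \<partial>M) = (\<integral>x. T c x \<partial>N)" for c
  proof -
    have "(\<integral>x. T c x \<partial>M) = (\<Sum>k<m. F (m - k) c / fact k * (\<integral>x. x ^ k \<partial>M))"
      unfolding T_def
      by (subst Bochner_Integration.integral_sum)
        (auto intro!: M.integrable_continuous continuous_intros)
    also have "\<dots> = (\<Sum>k<m. F (m - k) c / fact k * (\<integral>x. x ^ k \<partial>N))"
      by (intro sum.cong) (auto simp: less.IH)
    also have "\<dots> = (\<integral>x. T c x \<partial>N)"
      unfolding T_def
      by (subst Bochner_Integration.integral_sum)
        (auto intro!: N.integrable_continuous continuous_intros)
    finally show ?thesis .
  qed
  then have h_r: "h m c = (\<integral>x. r c x \<partial>M) - (\<integral>x. r c x \<partial>N)" for c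
    unfolding h_def r_def
    using M.integrable_continuous[OF contF'] M.integrable_continuous[OF contT]
      N.integrable_continuous[OF contF'] N.integrable_continuous[OF contT]
    by simp
  \<comment> \<open>In the Lagrange remainder the derivative of order \<open>m\<close> is \<phi>
    itself, which is bounded; this bounds the remainder uniformly in \<open>c\<close>.\<close>
  have taylor: "\<exists>t. \<bar>t\<bar> \<le> \<bar>x\<bar> \<and> r c x = \<phi> (c + t) / fact m * x ^ m" for c x
  proof -
    have "\<exists>t. \<bar>t\<bar> \<le> \<bar>x\<bar> \<and> F m (c + x) =
        (\<Sum>k<m. F (m - k) (c + 0) / fact k * x ^ k) + F (m - m) (c + t) / fact m * x ^ m"
    proof (rule Maclaurin_bi_le)
      show "\<forall>k t. k < m \<and> \<bar>t\<bar> \<le> \<bar>x\<bar> \<longrightarrow>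
          ((\<lambda>t. F (m - k) (c + t)) has_real_derivative F (m - Suc k) (c + t)) (at t)"
      proof (intro allI impI)
        fix k t assume "k < m \<and> \<bar>t\<bar> \<le> \<bar>x\<bar>"
        then have "(F (m - k) has_real_derivative F (m - Suc k) (t + c)) (at (t + c))"
          using F by (metis Suc_diff_Suc)
        then have "((\<lambda>t. F (m - k) (t + c)) has_real_derivative F (m - Suc k) (t + c)) (at t)"
          by (rule DERIV_shift[THEN iffD1])
        then show "((\<lambda>t. F (m - k) (c + t)) has_real_derivative F (m - Suc k) (c + t)) (at t)"
          by (simp add: add.commute)
      qed
    qed simp
    then show ?thesis by (auto simp: r_def T_def F0)
  qed
  define d where "d = ((\<integral>x. x ^ m \<partial>M) - (\<integral>x. x ^ m \<partial>N)) / fact m"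
  \<comment> \<open>The intermediate point of the remainder varies with \<open>n\<close>, so the
    limit \<open>L\<close> of \<phi> along \<open>a\<close> is required to survive every bounded
    perturbation.\<close>
  have lim: "(\<lambda>n. h m (a n)) \<longlonglongrightarrow> L * d"
    if a: "\<And>t K. (\<And>n :: nat. \<bar>t n\<bar> \<le> K) \<Longrightarrow> (\<lambda>n. \<phi> (a n + t n)) \<longlonglongrightarrow> L" for a L
  proof -
    have bound: "\<bar>r c x\<bar> \<le> B / fact m * \<bar>R\<bar> ^ m" if "\<bar>x\<bar> \<le> R" for c x
    proof -
      obtain t where t: "r c x = \<phi> (c + t) / fact m * x ^ m" using taylor by blast
      have "\<bar>x\<bar> ^ m \<le> \<bar>R\<bar> ^ m" using that by (intro power_mono) auto
      moreover have "0 \<le> B" using B[of 0] by linarith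
      ultimately show ?thesis
        unfolding t abs_mult abs_divide power_abs
        by (intro mult_mono) (auto intro!: divide_right_mono B)
    qed
    have conv: "(\<lambda>n. r (a n) x) \<longlonglongrightarrow> L / fact m * x ^ m" for x
    proof -
      obtain t where t: "\<And>n. \<bar>t n\<bar> \<le> \<bar>x\<bar>" "\<And>n. r (a n) x = \<phi> (a n + t n) / fact m * x ^ m"
        using taylor[of x "a _"] by metis
      show ?thesis unfolding t(2) by (intro tendsto_intros a[of t "\<bar>x\<bar>"] t(1)) auto
    qed
    have meas: "r c \<in> borel_measurable borel" "(\<lambda>x. L / fact m * x ^ m) \<in> borel_measurable borel" for c
      using contr by (auto intro!: borel_measurable_continuous_onI)
    have "(\<lambda>n. (\<integral>x. r (a n) x \<partial>M) - (\<integral>x. r (a n) x \<partial>N))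
        \<longlonglongrightarrow> (\<integral>x. L / fact m * x ^ m \<partial>M) - (\<integral>x. L / fact m * x ^ m \<partial>N)"
      by (intro tendsto_diff M.tendsto_integral[OF meas conv bound]
          N.tendsto_integral[OF meas conv bound])
    then show ?thesis by (simp add: h_r d_def algebra_simps diff_divide_distrib)
  qed
  \<comment> \<open>The factors 1 and 0 are the limits of \<phi> at plus and minus infinity, and the
    equation forces \<open>d\<close> to vanish.\<close>
  have "1 * d = 0 * d"
  proof (rule bounded_iterated_derivative_zero_const[OF h0 h_deriv])
    show "(\<lambda>n. h m (real n)) \<longlonglongrightarrow> 1 * d"
    proof (rule lim)
      fix t :: "nat \<Rightarrow> real" and K assume t: "\<And>n. \<bar>t n\<bar> \<le> K"
      have "filterlim (\<lambda>n. real n + t n) at_top sequentially"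
      proof (rule filterlim_at_top_mono)
        show "filterlim (\<lambda>n. - K + real n) at_top sequentially"
          by (rule filterlim_tendsto_add_at_top[OF tendsto_const filterlim_real_sequentially])
        show "\<forall>\<^sub>F n in sequentially. - K + real n \<le> real n + t n"
          using t by (intro always_eventually) (simp add: abs_le_iff minus_le_iff)
      qed
      then show "(\<lambda>n. \<phi> (real n + t n)) \<longlonglongrightarrow> 1" by (rule filterlim_compose[OF \<phi>(3)])
    qed
    show "(\<lambda>n. h m (- real n)) \<longlonglongrightarrow> 0 * d"
    proof (rule lim)
      fix t :: "nat \<Rightarrow> real" and K assume t: "\<And>n. \<bar>t n\<bar> \<le> K"
      have "filterlim (\<lambda>n. - real n + t n) at_bot sequentially"
      proof (rule filterlim_at_bot_mono)
        show "filterlim (\<lambda>n. - (- K + real n)) at_bot sequentially"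
          unfolding filterlim_uminus_at_bot minus_minus
          by (rule filterlim_tendsto_add_at_top[OF tendsto_const filterlim_real_sequentially])
        show "\<forall>\<^sub>F n in sequentially. - real n + t n \<le> - (- K + real n)"
          using t by (intro always_eventually) (simp add: abs_le_iff)
      qed
      then show "(\<lambda>n. \<phi> (- real n + t n)) \<longlonglongrightarrow> 0" by (rule filterlim_compose[OF \<phi>(2)])
    qed
    show "filterlim (\<lambda>n. real n) at_infinity sequentially"
      by (rule filterlim_at_top_imp_at_infinity[OF filterlim_real_sequentially])
    then show "filterlim (\<lambda>n. - real n) at_infinity sequentially"
      by (simp add: filterlim_at_infinity_conv_norm_at_top)
  qed
  then show ?case by (simp add: d_def)
qed

text \<open>Weierstrass approximation on the common support interval carries equality from
  polynomials to continuous functions. Continuous ramps carry it on to open half-lines, which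
  determine a finite Borel measure.\<close>

lemma measure_eq_of_moments:
  assumes M: "compactly_supported_measure M R" and N: "compactly_supported_measure N R"
    and eq: "\<And>m :: nat. (\<integral>x. x ^ m \<partial>M) = (\<integral>x. x ^ m \<partial>N)"
  shows "M = N"
proof -
  interpret M: compactly_supported_measure M R by (rule M)
  interpret N: compactly_supported_measure N R by (rule N)
  have poly: "(\<integral>x. p x \<partial>M) = (\<integral>x. p x \<partial>N)" if *: "real_polynomial_function p" for p :: "real \<Rightarrow> real"
  proof -
    obtain a n where p: "p = (\<lambda>x. \<Sum>i\<le>n. a i * x ^ i)"
      using * unfolding real_polynomial_function_iff_sum by blast
    show ?thesis
      unfolding p
      by (simp add: M.integrable_continuous N.integrable_continuous continuous_intros eq
          Bochner_Integration.integral_sum)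
  qed
  have cont: "(\<integral>x. f x \<partial>M) = (\<integral>x. f x \<partial>N)" if f: "continuous_on UNIV f" for f :: "real \<Rightarrow> real"
  proof -
    have "\<exists>p. real_polynomial_function p \<and> (\<forall>x\<in>{-R..R}. \<bar>f x - p x\<bar> < inverse (Suc n))" for n :: nat
      by (rule Stone_Weierstrass_real_polynomial_function[of "{-R..R}" f "inverse (Suc n)"])
        (auto intro: continuous_on_subset[OF f])
    then obtain p where p: "real_polynomial_function (p n)"
      "x \<in> {-R..R} \<Longrightarrow> \<bar>f x - p n x\<bar> < inverse (real (Suc n))" for n x
      using choice[of "\<lambda>n p. real_polynomial_function p \<and> (\<forall>x\<in>{-R..R}. \<bar>f x - p x\<bar> < inverse (Suc n))"]
      by blast
    have contp: "continuous_on UNIV (p n)" for n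
      by (intro continuous_at_imp_continuous_on ballI continuous_real_polymonial_function p(1))
    have conv: "(\<lambda>n. p n x) \<longlonglongrightarrow> f x" if "\<bar>x\<bar> \<le> R" for x
    proof (rule Lim_null[THEN iffD2], rule Lim_null_comparison)
      have "\<bar>p n x - f x\<bar> \<le> inverse (real (Suc n))" for n
        using p(2)[of x n] that by (simp add: abs_le_iff abs_less_iff)
      then show "\<forall>\<^sub>F n in sequentially. norm (p n x - f x) \<le> inverse (real (Suc n))"
        by (intro always_eventually) simp
    qed (rule LIMSEQ_inverse_real_of_nat)
    obtain B where B: "\<And>x. x \<in> {-R..R} \<Longrightarrow> \<bar>f x\<bar> \<le> B"
      using continuous_abs_bounded_Icc[OF f] by blast
    have bound: "\<bar>p n x\<bar> \<le> B + 1" if "\<bar>x\<bar> \<le> R" for n x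
    proof -
      have x: "x \<in> {-R..R}" using that by (simp add: abs_le_iff)
      have "inverse (real (Suc n)) \<le> 1" by (simp add: field_simps)
      then show ?thesis using B[OF x] p(2)[OF x, of n] by linarith
    qed
    note meas = borel_measurable_continuous_onI[OF contp] borel_measurable_continuous_onI[OF f]
    have "(\<lambda>n. \<integral>x. p n x \<partial>N) \<longlonglongrightarrow> (\<integral>x. f x \<partial>M)"
      using M.tendsto_integral[OF meas conv bound] unfolding poly[OF p(1)] .
    then show ?thesis
      using N.tendsto_integral[OF meas conv bound] by (rule LIMSEQ_unique)
  qed
  have "measure M {s<..} = measure N {s<..}" for s :: real
  proof -
    \<comment> \<open>For positive \<open>n\<close> the ramp rises from 0 at \<open>s\<close> to 1
      at \<open>s + 1 / n\<close>; its value 0 at \<open>s\<close> matches the open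
      half-line.\<close>
    define f where "f n x = min 1 (max 0 (real n * (x - s)))" for n :: nat and x
    have contf: "continuous_on UNIV (f n)" for n
      unfolding f_def by (intro continuous_intros)
    have conv: "(\<lambda>n. f n x) \<longlonglongrightarrow> indicator {s<..} x" for x
    proof (cases "s < x")
      case True
      have "\<forall>\<^sub>F n in sequentially. real n * (x - s) \<ge> 1"
      proof (rule eventually_sequentiallyI)
        fix n assume "nat \<lceil>1 / (x - s)\<rceil> \<le> n"
        then have "1 / (x - s) \<le> real n" by linarith
        with True show "1 \<le> real n * (x - s)" by (simp add: field_simps)
      qed
      then have "\<forall>\<^sub>F n in sequentially. f n x = 1"
        by eventually_elim (simp add: f_def)
      with True show ?thesis by (simp add: tendsto_eventually)
    next
      case False
      then have "real n * (x - s) \<le> 0" for n by (simp add: mult_nonneg_nonpos)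
      then have "f n x = 0" for n by (simp add: f_def max_absorb1)
      with False show ?thesis by simp
    qed
    have bound: "\<bar>f n x\<bar> \<le> 1" for n x by (simp add: f_def)
    have "(indicator {s<..} :: real \<Rightarrow> real) \<in> borel_measurable borel" by simp
    note meas = borel_measurable_continuous_onI[OF contf] this
    have "(\<lambda>n. \<integral>x. f n x \<partial>N) \<longlonglongrightarrow> (\<integral>x. indicator {s<..} x \<partial>M)"
      using M.tendsto_integral[OF meas conv bound] unfolding cont[OF contf] .
    then have "(\<integral>x. indicator {s<..} x \<partial>M) = (\<integral>x. indicator {s<..} x \<partial>N :: real)"
      using N.tendsto_integral[OF meas conv bound] by (rule LIMSEQ_unique)
    then show ?thesis
      using sets_eq_imp_space_eq[OF M.sets_borel] sets_eq_imp_space_eq[OF N.sets_borel] by simp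
  qed
  then show ?thesis
    by (intro measure_eqI_lessThan)
      (auto simp: M.sets_borel N.sets_borel M.emeasure_eq_measure N.emeasure_eq_measure)
qed

theorem measure_eq_of_sigmoidal_translates:
  fixes \<phi> :: "real \<Rightarrow> real"
  assumes "compactly_supported_measure M R" "compactly_supported_measure N R"
    and "continuous_on UNIV \<phi>" "(\<phi> \<longlongrightarrow> 0) at_bot" "(\<phi> \<longlongrightarrow> 1) at_top"
    and "\<And>c. (\<integral>x. \<phi> (c + x) \<partial>M) = (\<integral>x. \<phi> (c + x) \<partial>N)"
  shows "M = N"
  by (rule measure_eq_of_moments[OF assms(1,2) moments_eq_of_translates[OF assms]])

section \<open>Density\<close>

lemma signed_measure_diff:
  assumes "finite_measure M" "finite_measure N" "sets M = sets P" "sets N = sets P"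
  shows "signed_measure P (\<lambda>A. measure M A - measure N A)"
  unfolding signed_measure_def
proof (intro conjI allI impI)
  fix A :: "nat \<Rightarrow> 'a set"
  assume "range A \<subseteq> sets P" "disjoint_family A"
  then show "(\<lambda>n. measure M (A n) - measure N (A n)) sums (measure M (\<Union>n. A n) - measure N (\<Union>n. A n))"
    using assms by (intro sums_diff finite_measure.finite_measure_UNION) simp_all
qed simp

text \<open>The triangle inequality bounds the sum over any countable partition by the two total
  masses together.\<close>

lemma total_variation_diff:
  assumes M: "finite_measure M" and N: "finite_measure N" and sets: "sets M = sets P" "sets N = sets P"
  shows "total_variation P (\<lambda>A. measure M A - measure N A) < \<infinity>"
proof -
  interpret M: finite_measure M by (rule M)
  interpret N: finite_measure N by (rule N)
  have "total_variation P (\<lambda>A. measure M A - measure N A) \<le> emeasure M (space P) + emeasure N (space P)"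
    unfolding total_variation_def
  proof (rule SUP_least)
    fix A :: "nat \<Rightarrow> 'a set"
    assume "A \<in> {A. range A \<subseteq> sets P \<and> disjoint_family A \<and> (\<Union>n. A n) = space P}"
    then have A: "range A \<subseteq> sets P" "disjoint_family A" "(\<Union>n. A n) = space P" by auto
    have "ennreal \<bar>measure M (A n) - measure N (A n)\<bar> \<le> emeasure M (A n) + emeasure N (A n)" for n
    proof -
      have "\<bar>measure M (A n) - measure N (A n)\<bar> \<le> measure M (A n) + measure N (A n)"
        using measure_nonneg[of M "A n"] measure_nonneg[of N "A n"] by linarith
      then show ?thesis
        by (simp add: M.emeasure_eq_measure N.emeasure_eq_measure ennreal_leI flip: ennreal_plus)
    qed
    then have "(\<Sum>n. ennreal \<bar>measure M (A n) - measure N (A n)\<bar>) \<le>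
        (\<Sum>n. emeasure M (A n) + emeasure N (A n))"
      by (intro suminf_le) auto
    also have "\<dots> = (\<Sum>n. emeasure M (A n)) + (\<Sum>n. emeasure N (A n))"
      by (intro suminf_add[symmetric]) auto
    also have "\<dots> = emeasure M (space P) + emeasure N (space P)"
      using A sets by (simp add: suminf_emeasure)
    finally show "(\<Sum>n. ennreal \<bar>measure M (A n) - measure N (A n)\<bar>) \<le>
        emeasure M (space P) + emeasure N (space P)" .
  qed
  also have "\<dots> < \<infinity>" by (simp add: less_top[symmetric])
  finally show ?thesis .
qed

theorem theorem2p3:
  fixes P :: "(nat \<Rightarrow> real option) measure"
    and W :: "((nat \<Rightarrow> real option) \<Rightarrow> real) set"
    and \<phi> :: "real \<Rightarrow> real"
  assumes "prob_space P"
    and "space P = UNIV"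
    and "sets P = sigma_sets UNIV cylinder_sets"
    and "\<And>X. X \<in> W \<Longrightarrow> X \<in> borel_measurable P"
    and "\<And>X. X \<in> W \<Longrightarrow> continuous_on UNIV X"
    and "separating P W"
    and "continuous_on UNIV \<phi>"
    and "(\<phi> \<longlongrightarrow> 0) at_bot"
    and "(\<phi> \<longlongrightarrow> 1) at_top"
  shows "closure (span {f :: (nat \<Rightarrow> real option) \<Rightarrow>\<^sub>C real.
           \<exists>X\<in>W. \<exists>c. \<forall>\<omega>. apply_bcontfun f \<omega> = \<phi> (X \<omega> + c)}) = UNIV"
    (is "closure (span ?G) = UNIV")
proof (rule ccontr)
  assume "closure (span ?G) \<noteq> UNIV"
  then obtain f where f: "f \<notin> closure (span ?G)" by auto
  obtain q :: "(nat \<Rightarrow> bool discrete) \<Rightarrow> (nat \<Rightarrow> real option)"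
    where q: "continuous_on UNIV q" "surj q"
    using cantor_onto_Omega by (elim exE conjE)
  obtain M N :: "(nat \<Rightarrow> real option) measure"
    where M: "finite_measure M" "sets M = sets borel" and N: "finite_measure N" "sets N = sets borel"
      and annihilates: "\<forall>s\<in>span ?G. (\<integral>x. apply_bcontfun s x \<partial>M) = (\<integral>x. apply_bcontfun s x \<partial>N)"
      and separates: "(\<integral>x. apply_bcontfun f x \<partial>M) \<noteq> (\<integral>x. apply_bcontfun f x \<partial>N)"
    using subspace_not_dense_annihilating_measures[OF q subspace_span f] by (elim exE conjE)
  interpret M: finite_measure M by (rule M(1))
  interpret N: finite_measure N by (rule N(1))
  have sets_P: "sets P = sets borel" using assms(3) borel_eq_cylinder_sets by simp
  have space: "space M = UNIV" "space N = UNIV"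
    using sets_eq_imp_space_eq[OF M(2)] sets_eq_imp_space_eq[OF N(2)] by simp_all
  \<comment> \<open>Compactness bounds \<open>X\<close>, so both image measures have compact
    support, and annihilation of the span says that they integrate all translates of \<phi>
    equally.\<close>
  have distr_eq: "distr M borel X = distr N borel X" if X: "X \<in> W" for X
  proof -
    note cont = assms(5)[OF X]
    have meas: "X \<in> borel_measurable M" "X \<in> borel_measurable N"
      unfolding measurable_cong_sets[OF M(2) refl] measurable_cong_sets[OF N(2) refl]
      by (rule borel_measurable_continuous_onI[OF cont])+
    obtain R where R: "\<forall>x\<in>range X. norm x \<le> R"
      using compact_imp_bounded[OF compact_continuous_image[OF cont compact_UNIV_Omega]]
      unfolding bounded_iff by (elim exE)
    show ?thesis
    proof (rule measure_eq_of_sigmoidal_translates[OF _ _ assms(7,8,9)])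
      have R': "\<bar>X \<omega>\<bar> \<le> R" for \<omega> using R by simp
      show "compactly_supported_measure (distr M borel X) R"
        unfolding compactly_supported_measure_def compactly_supported_measure_axioms_def
        using meas R' by (simp add: M.finite_measure_distr AE_distr_iff)
      show "compactly_supported_measure (distr N borel X) R"
        unfolding compactly_supported_measure_def compactly_supported_measure_axioms_def
        using meas R' by (simp add: N.finite_measure_distr AE_distr_iff)
    next
      fix c
      have cont': "continuous_on UNIV (\<lambda>\<omega>. \<phi> (X \<omega> + c))"
        by (intro continuous_on_compose2[OF assms(7)] continuous_intros cont) auto
      define g where "g = Bcontfun (\<lambda>\<omega>. \<phi> (X \<omega> + c))"
      have g: "apply_bcontfun g = (\<lambda>\<omega>. \<phi> (X \<omega> + c))"
        unfolding g_def by (rule compact_apply_Bcontfun[OF compact_UNIV_Omega cont'])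
      have "g \<in> span ?G" by (rule span_base) (use X g in auto)
      with annihilates have "(\<integral>\<omega>. \<phi> (X \<omega> + c) \<partial>M) = (\<integral>\<omega>. \<phi> (X \<omega> + c) \<partial>N)"
        unfolding g[symmetric] by (rule bspec)
      moreover have "(\<lambda>x. \<phi> (c + x)) \<in> borel_measurable borel"
        by (intro borel_measurable_continuous_onI continuous_on_compose2[OF assms(7)] continuous_intros) auto
      ultimately show "(\<integral>x. \<phi> (c + x) \<partial>distr M borel X) = (\<integral>x. \<phi> (c + x) \<partial>distr N borel X)"
        by (simp add: integral_distr[OF meas(1)] integral_distr[OF meas(2)] add.commute)
    qed
  qed
  have "measure M {\<omega>. X \<omega> \<in> B} = measure N {\<omega>. X \<omega> \<in> B}" if X: "X \<in> W" and B: "B \<in> sets borel" for X B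
  proof -
    have meas: "X \<in> borel_measurable M" "X \<in> borel_measurable N"
      unfolding measurable_cong_sets[OF M(2) refl] measurable_cong_sets[OF N(2) refl]
      by (rule borel_measurable_continuous_onI[OF assms(5)[OF X]])+
    have "measure (distr M borel X) B = measure (distr N borel X) B" by (simp add: distr_eq[OF X])
    then show ?thesis by (simp add: measure_distr meas B space vimage_def)
  qed
  \<comment> \<open>Preimages of open half-lines and of points are the two kinds of sets in the
    separation property.\<close>
  from this[of _ "{_<..}"] this[of _ "{_}"]
  have vanish: "\<forall>X\<in>W. \<forall>s. measure M {\<omega> \<in> space P. X \<omega> > s} - measure N {\<omega> \<in> space P. X \<omega> > s} = 0 \<and>
      measure M {\<omega> \<in> space P. X \<omega> = s} - measure N {\<omega> \<in> space P. X \<omega> = s} = 0"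
    by (simp add: assms(2))
  have sets: "sets M = sets P" "sets N = sets P" using M(2) N(2) sets_P by simp_all
  \<comment> \<open>The difference of \<open>M\<close> and \<open>N\<close> is a signed measure of
    finite total variation, so the separation property makes it zero, contrary to their different
    integrals of \<open>f\<close>.\<close>
  have "\<forall>A\<in>sets P. measure M A - measure N A = 0"
    using assms(6)[unfolded separating_def, rule_format,
        OF signed_measure_diff[OF M(1) N(1) sets] total_variation_diff[OF M(1) N(1) sets]] vanish
    by blast
  then have "emeasure M A = emeasure N A" if "A \<in> sets M" for A
    using that sets by (simp add: M.emeasure_eq_measure N.emeasure_eq_measure)
  then have "M = N" using sets by (intro measure_eqI) simp_all
  with separates show False by simp
qed

end
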